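(* Let $n\ge 1$ be an integer and let $N=p_1^{k_1}\cdots p_r^{k_r}$ with $r\ge 1$, $p_1,\dots,p_r$ distinct primes and $k_1,\dots,k_r\ge 1$ integers. Then for every set $S\subseteq (\mathbb{Z}/N\mathbb{Z})^n$, $$|S|\;\ge\; \frac{C_{N,n}}{|\mathbb{P}(\mathbb{Z}/N\mathbb{Z})^{n-1}|}\sum_{u\in \mathbb{P}(\mathbb{Z}/N\mathbb{Z})^{n-1}}\ \sup_{a\in (\mathbb{Z}/N\mathbb{Z})^n}\bigl|\{a+tu : t\in \mathbb{Z}/N\mathbb{Z}\}\cap S\bigr|^n ,$$ where $$C_{N,n}=\left(\prod_{j=1}^{r-1}\frac{1}{k_j\log(p_j)+1}\ \prod_{i=1}^r\frac{1}{2\left(k_i+\lceil\log_{p_i}(n)\rceil\right)}\right)^n.$$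
   Context: For $N=p_1^{k_1}\cdots p_r^{k_r}$ ($p_i$ distinct primes), the projective space $\mathbb{P}(\mathbb{Z}/N\mathbb{Z})^{n-1}$ consists of the vectors $u\in(\mathbb{Z}/N\mathbb{Z})^n$ such that, for every $i\in\{1,\dots,r\}$, $u \bmod p_i^{k_i}$ has at least one coordinate that is a unit, taken up to multiplication by units in $(\mathbb{Z}/N\mathbb{Z})^\times$. One representative in $(\mathbb{Z}/N\mathbb{Z})^n$ is fixed for each element, so that $\mathbb{P}(\mathbb{Z}/N\mathbb{Z})^{n-1}$ is regarded as a subset of $(\mathbb{Z}/N\mathbb{Z})^n$ (the set of lines in a given direction does not depend on the representative). A line in direction $u$ is a set $\{a+tu : t\in\mathbb{Z}/N\mathbb{Z}\}$ with $a\in(\mathbb{Z}/N\mathbb{Z})^n$. $\log$ denotes the natural logarithm and $\log_p$ the logarithm to base $p$; an empty product is $1$. *)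

theory Defs
  imports "HOL-Number_Theory.Residues"
begin

abbreviation Zmod :: "nat \<Rightarrow> int ring"
  where "Zmod N \<equiv> residue_ring (int N)"

definition vecs :: "nat \<Rightarrow> nat \<Rightarrow> (nat \<Rightarrow> int) set"
  where "vecs N n = {..<n} \<rightarrow>\<^sub>E carrier (Zmod N)"

definition scale :: "nat \<Rightarrow> nat \<Rightarrow> int \<Rightarrow> (nat \<Rightarrow> int) \<Rightarrow> (nat \<Rightarrow> int)"
  where "scale N n c u = (\<lambda>i\<in>{..<n}. c \<otimes>\<^bsub>Zmod N\<^esub> u i)"

definition line :: "nat \<Rightarrow> nat \<Rightarrow> (nat \<Rightarrow> int) \<Rightarrow> (nat \<Rightarrow> int) \<Rightarrow> (nat \<Rightarrow> int) set"
  where "line N n a u =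
    {(\<lambda>i\<in>{..<n}. a i \<oplus>\<^bsub>Zmod N\<^esub> t \<otimes>\<^bsub>Zmod N\<^esub> u i) | t. t \<in> carrier (Zmod N)}"

text \<open>
  The modulus is presented by its factorisation: \<open>p 1, \<dots>, p r\<close> are the primes and
  \<open>k 1, \<dots>, k r\<close> their exponents.
\<close>

definition modulus :: "nat \<Rightarrow> (nat \<Rightarrow> nat) \<Rightarrow> (nat \<Rightarrow> nat) \<Rightarrow> nat"
  where "modulus r p k = (\<Prod>i=1..r. p i ^ k i)"

definition direction_vecs :: "nat \<Rightarrow> (nat \<Rightarrow> nat) \<Rightarrow> (nat \<Rightarrow> nat) \<Rightarrow> nat \<Rightarrow> (nat \<Rightarrow> int) set"
  where "direction_vecs r p k n =
    {u \<in> vecs (modulus r p k) n.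
      \<forall>i\<in>{1..r}. \<exists>j<n. u j mod int (p i ^ k i) \<in> Units (Zmod (p i ^ k i))}"

definition proj_rel ::
    "nat \<Rightarrow> (nat \<Rightarrow> nat) \<Rightarrow> (nat \<Rightarrow> nat) \<Rightarrow> nat \<Rightarrow> ((nat \<Rightarrow> int) \<times> (nat \<Rightarrow> int)) set"
  where "proj_rel r p k n =
    {(u, v). u \<in> direction_vecs r p k n \<and> v \<in> direction_vecs r p k n \<and>
      (\<exists>c \<in> Units (Zmod (modulus r p k)). v = scale (modulus r p k) n c u)}"

text \<open>
  The projective space \<open>\<P>(\<int>/N\<int>)\<^sup>n\<^sup>-\<^sup>1\<close>; its points are the classes themselves, and a choice of
  representatives is a function \<open>rep\<close> with \<open>rep L \<in> L\<close> for every point \<open>L\<close>.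
\<close>

definition proj_space ::
    "nat \<Rightarrow> (nat \<Rightarrow> nat) \<Rightarrow> (nat \<Rightarrow> nat) \<Rightarrow> nat \<Rightarrow> (nat \<Rightarrow> int) set set"
  where "proj_space r p k n = direction_vecs r p k n // proj_rel r p k n"

definition kakeya_const :: "nat \<Rightarrow> (nat \<Rightarrow> nat) \<Rightarrow> (nat \<Rightarrow> nat) \<Rightarrow> nat \<Rightarrow> real"
  where "kakeya_const r p k n =
    ((\<Prod>j\<in>{1..<r}. 1 / (real (k j) * ln (real (p j)) + 1)) *
     (\<Prod>i=1..r. 1 / (2 * (real (k i) + of_int \<lceil>log (real (p i)) (real n)\<rceil>)))) ^ n"

end

theory Submission
  imports Defs "HOL-Library.Function_Algebras" "HOL-Computational_Algebra.Polynomial" "HOL-Algebra.Exponent"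
begin

text \<open>
  Prime powers: let \<open>q = p ^ k\<close> and let \<open>\<zeta>\<close> be a primitive q-th root of unity. The points of \<open>S\<close>
  become the points \<open>\<zeta> ^ x\<close>, and a line in direction \<open>u\<close> becomes a piece of the monomial curve
  \<open>y \<mapsto> (\<zeta> ^ a\<^sub>j * y ^ u\<^sub>j)\<^sub>j\<close>. If the line has m points in \<open>S\<close>, then the derivatives of order below M at
  the points of \<open>S\<close> determine the first \<open>M * m\<close> divided differences of a polynomial along that curve.
  These lie in \<open>\<int>[\<zeta>]\<close>, and modulo \<open>1 - \<zeta>\<close> they are the coefficients of \<open>f ((1 + Y) ^ u)\<close> over
  \<open>\<int>/p\<close>. For directions with a coordinate equal to 1 the coefficients of degree \<open>e \<ge> K * (sum of u)\<close>, where
  \<open>K = k + l\<close> and \<open>M = p ^ l \<ge> n\<close>, are linearly independent modulo p, also after a translation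
  of all \<open>u\<close>. Comparing ranks and averaging over the translations gives the bound for such
  directions; averaging over all linear forms gives it for all directions.

  General moduli: the fibres of \<open>S\<close> over \<open>(\<int>/q)\<^sup>n\<close> reduce the modulus \<open>q * N\<close> to \<open>N\<close> and to a maximal
  inequality for functions on \<open>(\<int>/q)\<^sup>n\<close>. The latter follows from the one for sets with a loss of the harmonic
  sum \<open>1 + 1/2 + \<dots> + 1/q \<le> 1 + ln q\<close>, which accounts for the logarithms in the constant.
\<close>

subsection \<open>Specialising roots of unity\<close>

text \<open>Over \<open>\<int>/q\<close> a nonzero polynomial may have more roots than its degree,
  so the polynomial method does not apply there directly. Exponentials move the points into the
  complex numbers, where a rank is bounded from above; reduction modulo \<open>1 - \<zeta>\<close>
  serves only to bound it from below. The ring \<open>\<int>[\<zeta>]\<close> is never built: its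
  elements are kept as integer polynomials \<open>g\<close>, with complex value
  \<open>eval_int g z\<close> and residue \<open>poly g 1\<close> modulo p. The 2 and the rounded
  logarithm come from the derivatives: n! times the number of those of order below \<open>M\<close>
  is at most \<open>(2 * M) ^ n\<close> once \<open>M \<ge> n\<close>. A line then gives at most
  \<open>M * q = p ^ (k + l)\<close> divided differences, and for exponents below
  \<open>p ^ K\<close> the loss in independence is a factor \<open>K\<close>; hence
  \<open>K = k + l\<close>. Translations are needed because a small exponent vector \<open>u\<close>
  yields more usable divided differences than a large one; averaging pairs every direction with
  every \<open>u\<close>. One prime escapes the logarithmic factor because the induction over the
  primes starts from it.\<close>

definition eval_int :: "int poly \<Rightarrow> complex \<Rightarrow> complex"
  where "eval_int g z = poly (map_poly of_int g) z"

lemma eval_int_0 [simp]: "eval_int 0 z = 0"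
  and eval_int_1 [simp]: "eval_int 1 z = 1"
  and eval_int_monom [simp]: "eval_int (monom c m) z = of_int c * z ^ m"
  by (simp_all add: eval_int_def map_poly_monom poly_monom)

lemma eval_int_add [simp]: "eval_int (f + g) z = eval_int f z + eval_int g z"
proof -
  have "map_poly of_int (f + g) = (map_poly of_int f + map_poly of_int g :: complex poly)"
    by (intro poly_eqI) (simp add: coeff_map_poly)
  then show ?thesis by (simp add: eval_int_def)
qed

lemma eval_int_diff [simp]: "eval_int (f - g) z = eval_int f z - eval_int g z"
  using eval_int_add [of "f - g" g z] by simp

lemma eval_int_mult [simp]: "eval_int (f * g) z = eval_int f z * eval_int g z"
proof -
  have "map_poly of_int (f * g) = (map_poly of_int f * map_poly of_int g :: complex poly)"
    by (intro poly_eqI) (simp add: coeff_map_poly coeff_mult)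
  then show ?thesis by (simp add: eval_int_def)
qed

lemma eval_int_power [simp]: "eval_int (f ^ m) z = eval_int f z ^ m"
  by (induction m) simp_all

lemma eval_int_sum [simp]: "eval_int (sum f A) z = (\<Sum>x\<in>A. eval_int (f x) z)"
  by (induction A rule: infinite_finite_induct) simp_all

lemma eval_int_prod [simp]: "eval_int (prod f A) z = (\<Prod>x\<in>A. eval_int (f x) z)"
  by (induction A rule: infinite_finite_induct) simp_all


text \<open>The sum is the cyclotomic polynomial of index \<open>p ^ k\<close> at \<open>z\<close>.
  With \<open>w = z ^ (p ^ (k - 1))\<close> it forces \<open>w ^ p = 1\<close> and
  \<open>w \<noteq> 1\<close>, whereas \<open>z ^ d = 1\<close> with \<open>0 < d < p ^ k\<close>
  would pass to the gcd of \<open>d\<close> and \<open>p ^ k\<close>, a divisor of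
  \<open>p ^ (k - 1)\<close>, and give \<open>w = 1\<close>.\<close>

lemma root_of_geometric_sum_primitive:
  fixes z :: complex and p k :: nat
  assumes "prime p" "k \<ge> 1" and root: "(\<Sum>i<p. z ^ (i * p ^ (k - 1))) = 0"
  shows "z ^ (p ^ k) = 1" and "inj_on (\<lambda>t. z ^ t) {..<p ^ k}"
proof -
  let ?w = "z ^ (p ^ (k - 1))"
  have p2: "p \<ge> 2" using assms(1) by (rule prime_ge_2_nat)
  have geo: "(\<Sum>i<p. ?w ^ i) = 0"
    using root by (simp add: power_mult [symmetric] mult.commute)
  have pk: "p ^ (k - 1) * p = p ^ k" using assms(2) by (metis Suc_diff_1 less_eq_Suc_le One_nat_def power_Suc mult.commute)
  have "?w ^ p - 1 = (?w - 1) * (\<Sum>i<p. ?w ^ i)" by (rule power_diff_1_eq)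
  then have wp: "?w ^ p = 1" using geo by simp
  show zq: "z ^ (p ^ k) = 1" using wp pk by (simp add: power_mult [symmetric])
  have w1: "?w \<noteq> 1"
  proof
    assume "?w = 1"
    then have "(\<Sum>i<p. ?w ^ i) = of_nat p" by simp
    then show False using geo p2 by simp
  qed
  have z0: "z \<noteq> 0" using zq p2 by (metis power_0_left power_eq_0_iff zero_neq_one not_numeral_le_zero)
  have key: "z ^ d \<noteq> 1" if d: "0 < d" "d < p ^ k" for d
  proof
    assume zd: "z ^ d = 1"
    define g where "g = gcd d (p ^ k)"
    have "z ^ g = 1"
    proof -
      obtain x y where "d * x - p ^ k * y = g \<or> False" "p ^ k * y \<le> d * x"
        using bezout_nat [of d "p ^ k"] d g_def
        by (metis add_implies_diff le_add2 mult.commute neq0_conv add_diff_cancel_left' le_add1)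
      then have e: "d * x = g + p ^ k * y" by auto
      have "z ^ (d * x) = 1" using zd by (simp add: power_mult)
      then show ?thesis using e zq by (simp add: power_add power_mult)
    qed
    moreover have "g dvd p ^ (k - 1)"
    proof -
      have "g dvd p ^ k" by (simp add: g_def)
      then obtain i where i: "i \<le> k" "g = p ^ i"
        using divides_primepow_nat [OF assms(1)] by auto
      have "g \<le> d" using d by (simp add: g_def gcd_le1_nat)
      then have "i \<noteq> k" using d i by auto
      then show ?thesis using i by (simp add: le_imp_power_dvd)
    qed
    ultimately have "?w = 1" by (metis dvd_def power_mult power_one)
    then show False using w1 by simp
  qed
  show "inj_on (\<lambda>t. z ^ t) {..<p ^ k}"
  proof (rule linorder_inj_onI')
    fix s t assume st: "s \<in> {..<p ^ k}" "t \<in> {..<p ^ k}" "s < t"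
    show "z ^ s \<noteq> z ^ t"
    proof
      assume "z ^ s = z ^ t"
      moreover have "z ^ t = z ^ s * z ^ (t - s)" using st by (simp flip: power_add)
      ultimately have "z ^ s * 1 = z ^ s * z ^ (t - s)" by simp
      then have "z ^ (t - s) = 1" using z0 by (metis mult_left_cancel power_not_zero)
      moreover have "t - s < p ^ k" using st by auto
      ultimately show False using key [of "t - s"] st by simp
    qed
  qed
qed

text \<open>If every root of the cyclotomic polynomial had a bad witness, the product of the
  witnesses would be a multiple of the cyclotomic polynomial, whose value at 1 is p.\<close>

lemma ex_root_of_unity_specializing:
  fixes p k :: nat
  assumes p: "prime p" and k: "k \<ge> 1"
  shows "\<exists>z::complex. z ^ (p ^ k) = 1 \<and> inj_on (\<lambda>t. z ^ t) {..<p ^ k} \<and>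
    (\<forall>g. eval_int g z = 0 \<longrightarrow> int p dvd poly g 1)"
proof -
  define Phi :: "int poly" where "Phi = (\<Sum>i<p. monom 1 (i * p ^ (k - 1)))"
  define Z where "Z = {z::complex. (\<Sum>i<p. z ^ (i * p ^ (k - 1))) = 0}"
  have p2: "p \<ge> 2" using p by (rule prime_ge_2_nat)
  let ?Q = "p ^ (k - 1)"
  have Q0: "?Q > 0" using p2 by simp
  have pk: "p * ?Q = p ^ k" using k by (metis Suc_diff_1 less_eq_Suc_le One_nat_def power_Suc)
  have coeffPhi: "coeff Phi m = (\<Sum>i<p. if i * ?Q = m then 1 else 0)" for m
    by (simp add: Phi_def coeff_sum)
  have coeff_top: "coeff Phi ((p - 1) * ?Q) = 1"
  proof -
    have "coeff Phi ((p - 1) * ?Q) = (\<Sum>i<p. if i = p - 1 then 1 else 0)"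
      unfolding coeffPhi using Q0 by (intro sum.cong) auto
    then show ?thesis using p2 by simp
  qed
  have deg: "degree Phi = (p - 1) * ?Q"
  proof (rule antisym)
    show "degree Phi \<le> (p - 1) * ?Q"
    proof (rule degree_le, intro allI impI)
      fix i assume i: "(p - 1) * ?Q < i"
      have "j * ?Q \<noteq> i" if "j < p" for j
      proof -
        have "j * ?Q \<le> (p - 1) * ?Q" using that by simp
        then show ?thesis using i by linarith
      qed
      then show "coeff Phi i = 0" unfolding coeffPhi by (intro sum.neutral) auto
    qed
    show "(p - 1) * ?Q \<le> degree Phi" using coeff_top by (intro le_degree) simp
  qed
  have monic: "lead_coeff Phi = 1" using coeff_top deg by simp
  have Phi0: "Phi \<noteq> 0" using monic by auto
  have Phi1: "poly Phi 1 = int p" by (simp add: Phi_def poly_sum poly_monom)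
  have polyPhi: "eval_int Phi z = (\<Sum>i<p. z ^ (i * ?Q))" for z :: complex
    by (simp add: Phi_def)
  \<comment> \<open>\<open>Phi\<close> has as many roots as its degree: the \<open>p ^ k\<close>-th
    roots of unity that are not \<open>?Q\<close>-th ones. This count stands in for the
    irreducibility of \<open>Phi\<close>.\<close>
  have cardZ: "card Z \<ge> (p - 1) * ?Q"
  proof -
    have sub: "{z::complex. z ^ (p ^ k) = 1} - {z. z ^ ?Q = 1} \<subseteq> Z"
    proof
      fix z :: complex assume z: "z \<in> {z. z ^ (p ^ k) = 1} - {z. z ^ ?Q = 1}"
      have "(z ^ ?Q) ^ p - 1 = (z ^ ?Q - 1) * (\<Sum>i<p. (z ^ ?Q) ^ i)" by (rule power_diff_1_eq)
      moreover have "(z ^ ?Q) ^ p = 1" using z pk by (simp add: power_mult [symmetric] mult.commute)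
      ultimately have "(\<Sum>i<p. (z ^ ?Q) ^ i) = 0" using z by simp
      then show "z \<in> Z" by (simp add: Z_def power_mult [symmetric] mult.commute)
    qed
    have finZ: "finite Z"
    proof (rule finite_subset)
      show "Z \<subseteq> {z. z ^ (p ^ k) = 1}" using root_of_geometric_sum_primitive(1)[OF p k] by (auto simp: Z_def)
      show "finite {z::complex. z ^ (p ^ k) = 1}" using p2 by (intro finite_roots_unity) (simp add: Suc_leI)
    qed
    have "card {z::complex. z ^ (p ^ k) = 1} - card {z::complex. z ^ ?Q = 1} \<le>
        card ({z::complex. z ^ (p ^ k) = 1} - {z. z ^ ?Q = 1})"
      using Q0 by (intro diff_card_le_card_Diff finite_roots_unity) auto
    also have "\<dots> \<le> card Z" by (intro card_mono finZ sub)
    finally show ?thesis using p2 Q0 pk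
      by (simp add: card_roots_unity_eq diff_mult_distrib)
  qed
  show ?thesis
  proof (rule ccontr)
    assume neg: "\<not> ?thesis"
    have "\<exists>g. eval_int g z = 0 \<and> \<not> int p dvd poly g 1" if "z \<in> Z" for z
      using neg root_of_geometric_sum_primitive[OF p k, of z] that unfolding Z_def by blast
    then obtain g where g: "\<And>z. z \<in> Z \<Longrightarrow> eval_int (g z) z = 0"
      "\<And>z. z \<in> Z \<Longrightarrow> \<not> int p dvd poly (g z) 1" by metis
    have finZ: "finite Z" using cardZ p2 Q0
      by (metis card.infinite diff_is_0_eq le_zero_eq mult_eq_0_iff not_less_eq_eq numeral_2_eq_2 One_nat_def neq0_conv)
    define G where "G = prod g Z"
    have G1: "\<not> int p dvd poly G 1"
    proof -
      have "prime (int p)" using p by simp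
      then show ?thesis unfolding G_def poly_prod using g(2) finZ
        by (simp add: prime_dvd_prod_iff)
    qed
    \<comment> \<open>Since \<open>Phi\<close> is monic, pseudo-division is division with remainder
      over the integers. The remainder vanishes on \<open>Z\<close>, which has more points than its
      degree allows.\<close>
    obtain q r where qr: "pseudo_divmod G Phi = (q, r)" by fastforce
    have GPhi: "G = Phi * q + r" using pseudo_divmod(1)[OF Phi0 qr] monic by simp
    have r: "r = 0 \<or> degree r < degree Phi" by (rule pseudo_divmod(2)[OF Phi0 qr])
    have "r = 0"
    proof (rule ccontr)
      assume r0: "r \<noteq> 0"
      let ?r = "map_poly of_int r :: complex poly"
      have r0': "?r \<noteq> 0" using r0 by (subst map_poly_eq_0_iff) auto
      have "Z \<subseteq> {z. poly ?r z = 0}"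
      proof
        fix z assume z: "z \<in> Z"
        have "eval_int G z = 0"
          unfolding G_def eval_int_prod using g(1)[OF z] z finZ by (intro prod_zero) auto
        then show "z \<in> {z. poly ?r z = 0}"
          using z polyPhi[of z] unfolding GPhi Z_def by (simp add: eval_int_def [of r])
      qed
      then have "card Z \<le> card {z. poly ?r z = 0}" by (intro card_mono poly_roots_finite r0')
      also have "\<dots> \<le> degree ?r" by (rule card_poly_roots_bound [OF r0'])
      also have "\<dots> < degree Phi" using r r0 by (simp add: degree_map_poly)
      finally show False using cardZ deg by simp
    qed
    then show False using GPhi Phi1 G1 by simp
  qed
qed

subsection \<open>Independence modulo p and divided differences\<close>

interpretation fun_vs: vector_space "\<lambda>(c::complex) (f :: 'v \<Rightarrow> complex) v. c * f v"
  by standard (auto simp: fun_eq_iff algebra_simps)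

text \<open>Gaussian elimination with pivots that are units modulo p: a pivot row is subtracted
  from the others after cross-multiplication, so that all entries stay in \<open>\<int>[X]\<close>.\<close>

lemma independent_of_independent_mod:
  fixes \<psi> :: "'i \<Rightarrow> 'v \<Rightarrow> int poly" and z :: complex and p :: int
  assumes p: "prime p" and z: "\<And>g. eval_int g z = 0 \<Longrightarrow> p dvd poly g 1"
    and "finite I"
    and "\<And>c i. (\<And>v. p dvd (\<Sum>i\<in>I. c i * poly (\<psi> i v) 1)) \<Longrightarrow> i \<in> I \<Longrightarrow> p dvd c i"
    and "\<And>v. (\<Sum>i\<in>I. d i * eval_int (\<psi> i v) z) = 0" and "i \<in> I"
  shows "d i = 0"
  using assms(3-)
proof (induction I arbitrary: \<psi> d i rule: finite_induct)
  case (insert k J)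
  note ind = insert.prems(1) and rel = insert.prems(2)
  have "\<exists>v. \<not> p dvd poly (\<psi> k v) 1"
  proof (rule ccontr)
    assume "\<not> ?thesis"
    then have "p dvd (\<Sum>i\<in>insert k J. (if i = k then 1 else 0) * poly (\<psi> i v) 1)" for v
      using insert.hyps by (intro dvd_sum) auto
    then have "p dvd (if k = k then 1 else 0)" by (rule ind) simp
    then show False using p by (simp add: not_prime_unit)
  qed
  then obtain w where w: "\<not> p dvd poly (\<psi> k w) 1" by blast
  then have w0: "eval_int (\<psi> k w) z \<noteq> 0" using z by blast
  define \<psi>' where "\<psi>' i v = \<psi> k w * \<psi> i v - \<psi> i w * \<psi> k v" for i v
  have J: "d j = 0" if j: "j \<in> J" for j
  proof (rule insert.IH [of "\<psi>'"])
    fix c i assume c: "\<And>v. p dvd (\<Sum>i\<in>J. c i * poly (\<psi>' i v) 1)" and i: "i \<in> J"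
    \<comment> \<open>A relation among the eliminated rows pulls back to the original ones: each
      coefficient is multiplied by the pivot, a unit modulo p, and the pivot row absorbs the
      subtracted terms.\<close>
    define c' where "c' i = (if i = k then - (\<Sum>i\<in>J. c i * poly (\<psi> i w) 1) else c i * poly (\<psi> k w) 1)" for i
    have "p dvd (\<Sum>i\<in>insert k J. c' i * poly (\<psi> i v) 1)" for v
    proof -
      have "(\<Sum>i\<in>J. c' i * poly (\<psi> i v) 1) = (\<Sum>i\<in>J. c i * poly (\<psi> k w) 1 * poly (\<psi> i v) 1)"
        using insert.hyps by (intro sum.cong) (auto simp: c'_def)
      then have "(\<Sum>i\<in>insert k J. c' i * poly (\<psi> i v) 1) =
          c' k * poly (\<psi> k v) 1 + (\<Sum>i\<in>J. c i * poly (\<psi> k w) 1 * poly (\<psi> i v) 1)"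
        using insert.hyps by simp
      also have "\<dots> = (\<Sum>i\<in>J. c i * poly (\<psi>' i v) 1)"
        by (simp add: c'_def \<psi>'_def sum_distrib_right right_diff_distrib sum_subtractf mult.assoc)
      finally have "(\<Sum>i\<in>insert k J. c' i * poly (\<psi> i v) 1) = (\<Sum>i\<in>J. c i * poly (\<psi>' i v) 1)" .
      then show ?thesis using c by simp
    qed
    then have "p dvd c' i" by (rule ind) (use i in auto)
    moreover have "i \<noteq> k" using i insert.hyps by auto
    ultimately show "p dvd c i" using w p by (simp add: c'_def prime_dvd_mult_iff)
  next
    fix v
    have dk: "d k * eval_int (\<psi> k x) z = - (\<Sum>i\<in>J. d i * eval_int (\<psi> i x) z)" for x
      using rel [of x] insert.hyps by (simp add: eq_neg_iff_add_eq_0)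
    have "(\<Sum>i\<in>J. d i * eval_int (\<psi>' i v) z) =
        eval_int (\<psi> k w) z * (\<Sum>i\<in>J. d i * eval_int (\<psi> i v) z)
        - (\<Sum>i\<in>J. d i * eval_int (\<psi> i w) z) * eval_int (\<psi> k v) z"
      by (simp add: \<psi>'_def sum_distrib_left sum_distrib_right sum_subtractf algebra_simps)
    also have "\<dots> = eval_int (\<psi> k w) z * - (d k * eval_int (\<psi> k v) z)
        - (- (d k * eval_int (\<psi> k w) z)) * eval_int (\<psi> k v) z"
      by (simp only: dk minus_minus)
    also have "\<dots> = 0" by (simp add: algebra_simps)
    finally show "(\<Sum>i\<in>J. d i * eval_int (\<psi>' i v) z) = 0" .
  qed (use j in auto)
  have "(\<Sum>i\<in>J. d i * eval_int (\<psi> i w) z) = 0" by (rule sum.neutral) (simp add: J)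
  then have "d k = 0" using rel [of w] w0 insert.hyps by simp
  then show ?case using J insert.prems(3) by auto
qed simp

lemma sum_fun_apply: "(\<Sum>x\<in>A. f x) v = (\<Sum>x\<in>A. f x v)" for f :: "'a \<Rightarrow> 'v \<Rightarrow> complex"
  by (induction A rule: infinite_finite_induct) simp_all

text \<open>Comparison of ranks: rows independent modulo p stay independent over the complex
  numbers, so they cannot outnumber a spanning set.\<close>

lemma card_le_of_independent_mod:
  fixes \<psi> :: "'i \<Rightarrow> 'v \<Rightarrow> int poly" and z :: complex and p :: int
  assumes p: "prime p" and z: "\<And>g. eval_int g z = 0 \<Longrightarrow> p dvd poly g 1"
    and I: "finite I"
    and ind: "\<And>c i. (\<And>v. p dvd (\<Sum>i\<in>I. c i * poly (\<psi> i v) 1)) \<Longrightarrow> i \<in> I \<Longrightarrow> p dvd c i"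
    and \<Theta>: "finite \<Theta>" and span: "\<And>i. i \<in> I \<Longrightarrow> (\<lambda>v. eval_int (\<psi> i v) z) \<in> fun_vs.span \<Theta>"
  shows "card I \<le> card \<Theta>"
proof -
  define f where "f i = (\<lambda>v. eval_int (\<psi> i v) z)" for i
  have zero: "d i = 0" if "\<And>v. (\<Sum>i\<in>I. d i * f i v) = 0" "i \<in> I" for d i
  proof (rule independent_of_independent_mod [where \<psi> = \<psi> and z = z and p = p and I = I and d = d])
    show "(\<Sum>i\<in>I. d i * eval_int (\<psi> i v) z) = 0" for v using that(1) by (simp add: f_def)
    show "p dvd c i" if "\<And>v. p dvd (\<Sum>i\<in>I. c i * poly (\<psi> i v) 1)" "i \<in> I" for c i
      using that by (rule ind)
  qed (use p z I that(2) in auto)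
  have inj: "inj_on f I"
  proof (rule inj_onI, rule ccontr)
    fix i j assume ij: "i \<in> I" "j \<in> I" "f i = f j" "i \<noteq> j"
    define d where "d l = (if l = i then 1 else if l = j then -1 else 0 :: complex)" for l
    have "(\<Sum>l\<in>I. d l * f l v) = 0" for v
    proof -
      have "(\<Sum>l\<in>I. d l * f l v) = (\<Sum>l\<in>{i, j}. d l * f l v)"
        using I ij by (intro sum.mono_neutral_right) (auto simp: d_def)
      then show ?thesis using ij by (simp add: d_def)
    qed
    then have "d i = 0" using ij(1) by (rule zero)
    then show False by (simp add: d_def)
  qed
  have "fun_vs.independent (f ` I)"
  proof (rule fun_vs.independent_if_scalars_zero)
    show "finite (f ` I)" using I by simp
    fix u g assume u: "(\<Sum>x\<in>f ` I. (\<lambda>v. u x * x v)) = 0" and g: "g \<in> f ` I"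
    have "(\<Sum>i\<in>I. u (f i) * f i v) = 0" for v
    proof -
      have "(\<Sum>i\<in>I. u (f i) * f i v) = (\<Sum>x\<in>f ` I. u x * x v)"
        using inj by (simp add: sum.reindex)
      also have "\<dots> = (\<Sum>x\<in>f ` I. (\<lambda>v. u x * x v)) v"
        by (simp add: sum_fun_apply)
      finally show ?thesis using u by simp
    qed
    then show "u g = 0" using zero [of "\<lambda>i. u (f i)"] g by auto
  qed
  then have "card (f ` I) \<le> card \<Theta>"
    using fun_vs.independent_span_bound [OF \<Theta>] span by (auto simp: f_def)
  then show ?thesis using inj by (simp add: card_image)
qed

text \<open>The complete homogeneous symmetric polynomial of degree \<open>s - e\<close> in \<open>z 0, \<dots>, z e\<close>,
  which is the divided difference of \<open>y ^ s\<close> at these nodes.\<close>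

fun chs :: "(nat \<Rightarrow> 'a::comm_ring_1) \<Rightarrow> nat \<Rightarrow> nat \<Rightarrow> 'a"
  where "chs z 0 s = z 0 ^ s"
  | "chs z (Suc e) 0 = 0"
  | "chs z (Suc e) (Suc s) = z (Suc e) * chs z (Suc e) s + chs z e s"

text \<open>When all nodes merge at 1, the divided difference becomes the Taylor coefficient of
  \<open>y ^ s\<close> there. This is what reduction modulo \<open>1 - \<zeta>\<close>
  leaves.\<close>

lemma chs_one: "(\<And>l. z l = 1) \<Longrightarrow> chs z e s = of_nat (s choose e)"
  by (induction z e s rule: chs.induct) simp_all

lemma poly_chs: "poly (chs z e s) x = chs (\<lambda>l. poly (z l) x) e s"
  by (induction z e s rule: chs.induct) (simp_all add: poly_power)

lemma eval_int_chs: "eval_int (chs z e s) x = chs (\<lambda>l. eval_int (z l) x) e s"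
  by (induction z e s rule: chs.induct) simp_all

text \<open>As a function of the exponent \<open>s\<close>, this is \<open>x ^ i / fact i\<close>
  times the i-th derivative of \<open>y ^ s\<close> at \<open>y = x\<close>.\<close>

definition exp_poly :: "complex \<Rightarrow> nat \<Rightarrow> nat \<Rightarrow> complex"
  where "exp_poly x i s = of_nat (s choose i) * x ^ s"

text \<open>A first-order linear recurrence with an exponential polynomial on the right. In the
  resonant case \<open>x = y\<close> the solution has degree one higher; otherwise the degree stays,
  and the lower terms are corrected by induction on \<open>i\<close>.\<close>

lemma ex_shift_minus_exp_poly:
  assumes x: "x \<noteq> 0" and B: "\<And>j. j \<le> i \<Longrightarrow> exp_poly x j \<in> B"
    and B': "x = y \<Longrightarrow> exp_poly x (Suc i) \<in> B"
  shows "\<exists>r\<in>fun_vs.span B. \<forall>s. r (Suc s) - y * r s = exp_poly x i s"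
proof (cases "x = y")
  case True
  show ?thesis
  proof (intro bexI allI)
    let ?r = "\<lambda>s. (1 / x) * exp_poly x (Suc i) s"
    show "?r \<in> fun_vs.span B" by (intro fun_vs.span_scale fun_vs.span_base B' True)
    show "?r (Suc s) - y * ?r s = exp_poly x i s" for s
      using x True by (simp add: exp_poly_def field_simps)
  qed
next
  case False
  define c where "c = 1 / (x - y)"
  have c: "c * (x - y) = 1" using False by (simp add: c_def)
  have solve: "c * (x * a + b) - y * (c * a) = a + c * b" for a b
  proof -
    have "c * (x * a + b) - y * (c * a) = (c * (x - y)) * a + c * b" by (simp add: algebra_simps)
    then show ?thesis using c by simp
  qed
  show ?thesis using B
  proof (induction i)
    case 0
    show ?case
    proof (intro bexI allI)
      let ?r = "\<lambda>s. c * exp_poly x 0 s"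
      show "?r \<in> fun_vs.span B" by (intro fun_vs.span_scale fun_vs.span_base 0) simp
      show "?r (Suc s) - y * ?r s = exp_poly x 0 s" for s
        using solve [of "x ^ s" 0] by (simp add: exp_poly_def)
    qed
  next
    case (Suc i)
    then obtain r where r: "r \<in> fun_vs.span B" "\<And>s. r (Suc s) - y * r s = exp_poly x i s" by auto
    show ?case
    proof (intro bexI allI)
      let ?r = "(\<lambda>s. c * exp_poly x (Suc i) s) - (\<lambda>s. (c * x) * r s)"
      show "?r \<in> fun_vs.span B"
        by (intro fun_vs.span_diff fun_vs.span_scale fun_vs.span_base r Suc.prems) simp
      show "?r (Suc s) - y * ?r s = exp_poly x (Suc i) s" for s
      proof -
        have "exp_poly x (Suc i) (Suc s) = x * exp_poly x (Suc i) s + x * exp_poly x i s"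
          by (simp add: exp_poly_def algebra_simps)
        moreover have "(c * (x * u + x * v) - c * x * w) - y * (c * u - c * x * w') =
            (c * (x * u + x * v) - y * (c * u)) - c * x * (w - y * w')" for u v w w'
          by (simp add: algebra_simps)
        ultimately have "?r (Suc s) - y * ?r s =
            (c * (x * exp_poly x (Suc i) s + x * exp_poly x i s) - y * (c * exp_poly x (Suc i) s))
            - c * x * (r (Suc s) - y * r s)"
          by (simp only: minus_apply)
        then show ?thesis unfolding r(2) solve by simp
      qed
    qed
  qed
qed

text \<open>With repeated nodes, a divided difference involves derivatives of order below the
  multiplicity of each node. The recursion of \<open>chs\<close> is a linear recurrence in
  \<open>s\<close> driven by the previous divided difference, so a new node adds at most one
  exponential polynomial.\<close>

lemma chs_in_span_exp_poly:
  assumes z: "\<And>l. z l \<noteq> 0"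
  shows "chs z e \<in> fun_vs.span {exp_poly x i | x i. i < card {l. l \<le> e \<and> z l = x}}"
proof (induction e)
  case 0
  have "chs z 0 = exp_poly (z 0) 0" by (simp add: fun_eq_iff exp_poly_def)
  moreover have "0 < card {l. l \<le> 0 \<and> z l = z 0}" by (auto simp: card_gt_0_iff)
  ultimately have "chs z 0 \<in> {exp_poly x i | x i. i < card {l. l \<le> 0 \<and> z l = x}}" by blast
  then show ?case by (rule fun_vs.span_base)
next
  case (Suc e)
  define B where "B m = {exp_poly x i | x i. i < card {l. l \<le> m \<and> z l = x}}" for m
  let ?y = "z (Suc e)"
  have mem: "exp_poly x i \<in> B m" if "i < card {l. l \<le> m \<and> z l = x}" for x i m
    using that by (auto simp: B_def)
  have cs: "{l. l \<le> Suc e \<and> z l = x} = {l. l \<le> e \<and> z l = x} \<union> (if x = ?y then {Suc e} else {})" for x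
    by (auto simp: le_Suc_eq)
  have card_Suc_y: "card {l. l \<le> Suc e \<and> z l = ?y} = Suc (card {l. l \<le> e \<and> z l = ?y})"
    unfolding cs by simp
  have card_mono': "card {l. l \<le> e \<and> z l = x} \<le> card {l. l \<le> Suc e \<and> z l = x}" for x
    by (intro card_mono) auto
  have "\<exists>r\<in>fun_vs.span (B (Suc e)). \<forall>s. r (Suc s) - ?y * r s = f s" if "f \<in> fun_vs.span (B e)" for f
    using that
  proof (induction rule: fun_vs.span_induct_alt)
    case base
    show ?case by (intro bexI [of _ 0] fun_vs.span_zero) simp
  next
    case (step c g f)
    then obtain x i where g: "g = exp_poly x i" and i: "i < card {l. l \<le> e \<and> z l = x}"
      by (auto simp: B_def)
    have x0: "x \<noteq> 0"
    proof
      assume "x = 0"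
      then have "{l. l \<le> e \<and> z l = x} = {}" using z by auto
      then show False using i by (simp only: card.empty)
    qed
    have "\<exists>r1\<in>fun_vs.span (B (Suc e)). \<forall>s. r1 (Suc s) - ?y * r1 s = exp_poly x i s"
    proof (rule ex_shift_minus_exp_poly [OF x0])
      show "exp_poly x j \<in> B (Suc e)" if "j \<le> i" for j
        by (rule mem) (use that i card_mono' [of x] in linarith)
      show "exp_poly x (Suc i) \<in> B (Suc e)" if "x = ?y"
        by (rule mem) (use that i card_Suc_y in simp)
    qed
    then obtain r1 where r1: "r1 \<in> fun_vs.span (B (Suc e))" "\<And>s. r1 (Suc s) - ?y * r1 s = g s"
      unfolding g by blast
    obtain r2 where r2: "r2 \<in> fun_vs.span (B (Suc e))" "\<And>s. r2 (Suc s) - ?y * r2 s = f s"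
      using step by auto
    show ?case
    proof (intro bexI allI)
      show "(\<lambda>v. c * r1 v) + r2 \<in> fun_vs.span (B (Suc e))"
        by (intro fun_vs.span_add fun_vs.span_scale r1 r2)
      show "((\<lambda>v. c * r1 v) + r2) (Suc s) - ?y * ((\<lambda>v. c * r1 v) + r2) s = ((\<lambda>v. c * g v) + f) s" for s
      proof -
        have "r1 (Suc s) = g s + ?y * r1 s" "r2 (Suc s) = f s + ?y * r2 s"
          using r1(2) [of s] r2(2) [of s] by (simp_all add: algebra_simps)
        then show ?thesis by (simp add: algebra_simps)
      qed
    qed
  qed
  then obtain r where r: "r \<in> fun_vs.span (B (Suc e))" "\<And>s. r (Suc s) - ?y * r s = chs z e s"
    using Suc.IH unfolding B_def [symmetric] by blast
  \<comment> \<open>The solution \<open>r\<close> of the recurrence may have the wrong initial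
    value; a multiple of the homogeneous solution \<open>?y ^ s\<close> repairs it.\<close>
  define c where "c = chs z (Suc e) 0 - r 0"
  have "chs z (Suc e) s = r s + c * exp_poly ?y 0 s" for s
  proof (induction s)
    case (Suc s)
    then show ?case using r(2) [of s] by (simp add: exp_poly_def algebra_simps)
  qed (simp add: c_def exp_poly_def)
  then have "chs z (Suc e) = r + (\<lambda>s. c * exp_poly ?y 0 s)" by (simp add: fun_eq_iff)
  moreover have "exp_poly ?y 0 \<in> B (Suc e)" by (rule mem) (simp add: card_Suc_y)
  ultimately have "chs z (Suc e) \<in> fun_vs.span (B (Suc e))"
    by (simp add: fun_vs.span_add fun_vs.span_base fun_vs.span_scale r)
  then show ?case by (simp add: B_def)
qed

subsection \<open>Orders modulo p\<close>

lemma abs_prime_int_ne_one: "prime (p::int) \<Longrightarrow> \<bar>p\<bar> \<noteq> 1"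
  using prime_gt_1_int [of p] by simp

text \<open>The order of vanishing at 0 of \<open>P\<close> modulo p. It is a relation because a
  polynomial divisible by p has no order.\<close>

definition order_mod :: "int \<Rightarrow> int poly \<Rightarrow> nat \<Rightarrow> bool"
  where "order_mod p P k \<longleftrightarrow> (\<forall>i<k. p dvd coeff P i) \<and> \<not> p dvd coeff P k"

lemma order_mod_mult:
  assumes p: "prime p" and P: "order_mod p P a" and Q: "order_mod p Q b"
  shows "order_mod p (P * Q) (a + b)"
proof -
  have low: "p dvd coeff P i * coeff Q (m - i)" if "i \<le> m" "m < a + b \<or> m = a + b \<and> i \<noteq> a" for i m
  proof (cases "i < a")
    case True
    then show ?thesis using P by (simp add: order_mod_def)
  next
    case False
    then have "m - i < b" using that by auto
    then show ?thesis using Q by (simp add: order_mod_def)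
  qed
  have "coeff (P * Q) (a + b) = coeff P a * coeff Q b + (\<Sum>i\<in>{..a + b} - {a}. coeff P i * coeff Q (a + b - i))"
    unfolding coeff_mult by (subst sum.remove [where x = a]) auto
  moreover have "p dvd (\<Sum>i\<in>{..a + b} - {a}. coeff P i * coeff Q (a + b - i))"
    by (intro dvd_sum low) auto
  moreover have "\<not> p dvd coeff P a * coeff Q b"
    using p P Q by (simp add: order_mod_def prime_dvd_mult_iff)
  ultimately have "\<not> p dvd coeff (P * Q) (a + b)" by (simp add: dvd_add_left_iff)
  moreover have "p dvd coeff (P * Q) m" if "m < a + b" for m
    unfolding coeff_mult using that by (intro dvd_sum low) auto
  ultimately show ?thesis by (simp add: order_mod_def)
qed

lemma order_mod_one: "prime p \<Longrightarrow> order_mod p 1 0"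
  by (simp add: order_mod_def abs_prime_int_ne_one)

lemma order_mod_prod:
  assumes "prime p" "\<And>x. x \<in> A \<Longrightarrow> order_mod p (P x) (f x)"
  shows "order_mod p (\<Prod>x\<in>A. P x) (\<Sum>x\<in>A. f x)"
  using assms by (induction A rule: infinite_finite_induct) (auto intro: order_mod_one order_mod_mult)

lemma coeff_one_plus_power: "coeff ([:1, 1:] ^ c) i = (of_nat (c choose i) :: int)"
proof (cases "i \<le> c")
  case True
  then show ?thesis by (simp add: coeff_linear_poly_power)
next
  case False
  then have "degree ([:1, 1 :: int:] ^ c) < i" using degree_power_le [of "[:1, 1 :: int:]" c] by simp
  then show ?thesis using False by (simp add: coeff_eq_0)
qed

lemma order_mod_one_plus_power: "prime p \<Longrightarrow> order_mod p ([:1, 1:] ^ c) 0"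
  unfolding order_mod_def coeff_one_plus_power by (simp add: abs_prime_int_ne_one)

text \<open>Write \<open>c = p ^ v * m\<close> with \<open>m\<close> prime to p. Modulo p,
  \<open>(1 + Y) ^ c - 1\<close> is \<open>(1 + Y ^ (p ^ v)) ^ m - 1\<close>, whose first
  coefficient is \<open>m\<close>; the proof reads this off the binomial coefficients.\<close>

lemma order_mod_one_plus_power_diff_one:
  fixes p c :: nat
  assumes p: "prime p" and c: "c > 0"
  shows "order_mod (int p) ([:1, 1:] ^ c - 1) (p ^ multiplicity p c)"
proof -
  let ?q = "p ^ multiplicity p c"
  define m where "m = c div ?q"
  have m: "c = ?q * m" unfolding m_def by (simp add: multiplicity_dvd)
  have p0: "p > 0" using p by (simp add: prime_gt_0_nat)
  have m0: "m > 0" using m c by (cases m) auto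
  have q0: "?q > 0" using p0 by simp
  have nm: "\<not> p dvd m"
    unfolding m_def using c p by (intro multiplicity_decompose) (auto simp: not_prime_unit)
  have "multiplicity p (c choose ?q) = multiplicity p m"
    using const_p_fac [OF m0 p, of "multiplicity p c"] m by simp
  also have "\<dots> = 0" using nm by (rule not_dvd_imp_multiplicity_0)
  finally have "multiplicity p (c choose ?q) = 0" .
  moreover have "c choose ?q > 0" using c by (intro zero_less_binomial dvd_imp_le multiplicity_dvd)
  ultimately have top: "\<not> p dvd (c choose ?q)"
    using p by (metis multiplicity_eq_zero_iff not_prime_unit neq0_conv)
  \<comment> \<open>By \<open>i * (c choose i) = c * (c - 1 choose (i - 1))\<close>, a binomial
    coefficient prime to p would make \<open>?q\<close> divide \<open>i\<close>.\<close>
  have low: "p dvd (c choose i)" if "0 < i" "i < ?q" for i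
  proof (rule ccontr)
    assume "\<not> p dvd (c choose i)"
    then have "coprime ?q (c choose i)" using p by (simp add: prime_imp_coprime)
    moreover have "?q dvd i * (c choose i)"
      using times_binomial_minus1_eq [OF that(1), of c] multiplicity_dvd [of p c] by simp
    ultimately have "?q dvd i" by (simp add: coprime_dvd_mult_left_iff)
    then show False using that by (simp add: nat_dvd_not_less)
  qed
  have cf: "coeff ([:1, 1:] ^ c - 1 :: int poly) i = (if i = 0 then 0 else int (c choose i))" for i
    by (simp add: coeff_one_plus_power coeff_1)
  show ?thesis unfolding order_mod_def cf using low top q0 by auto
qed

text \<open>Bound \<open>p ^ multiplicity p b\<close> by the sum of all \<open>p ^ i\<close>
  dividing \<open>b\<close> with \<open>i < K\<close>. Each \<open>i\<close> occurs for at most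
  \<open>a div p ^ i\<close> values of \<open>b\<close> and so contributes at most \<open>a\<close>.
  This is the origin of the factor \<open>K\<close>.\<close>

lemma sum_prime_power_multiplicity_le:
  fixes p :: nat
  assumes p: "prime p" and a: "a < p ^ K"
  shows "(\<Sum>b=1..a. p ^ multiplicity p b) \<le> K * a"
proof -
  have card: "card {b\<in>{1..a}. d dvd b} \<le> a div d" if "d > 0" for d :: nat
  proof -
    have "{b\<in>{1..a}. d dvd b} \<subseteq> (\<lambda>t. d * t) ` {1..a div d}"
    proof
      fix b assume b: "b \<in> {b\<in>{1..a}. d dvd b}"
      then obtain t where t: "b = d * t" by auto
      then have "t \<le> a div d" using b that by (auto simp: less_eq_div_iff_mult_less_eq mult.commute)
      moreover have "1 \<le> t" using b t by (cases t) auto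
      ultimately show "b \<in> (\<lambda>t. d * t) ` {1..a div d}" using t by auto
    qed
    then have "card {b\<in>{1..a}. d dvd b} \<le> card ((\<lambda>t. d * t) ` {1..a div d})" by (intro card_mono) auto
    also have "\<dots> \<le> a div d" using card_image_le [of "{1..a div d}" "\<lambda>t. d * t"] by simp
    finally show ?thesis .
  qed
  have "(\<Sum>b=1..a. p ^ multiplicity p b) \<le> (\<Sum>b=1..a. \<Sum>i<K. if p ^ i dvd b then p ^ i else 0)"
  proof (rule sum_mono)
    fix b assume b: "b \<in> {1..a}"
    have "p ^ multiplicity p b \<le> b" using b by (intro dvd_imp_le multiplicity_dvd) auto
    then have "p ^ multiplicity p b < p ^ K" using a b by auto
    then have "multiplicity p b < K" using p by (metis power_less_imp_less_exp prime_gt_1_nat)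
    then have "(if p ^ multiplicity p b dvd b then p ^ multiplicity p b else 0)
        \<le> (\<Sum>i<K. if p ^ i dvd b then p ^ i else 0)"
      by (intro member_le_sum) auto
    then show "p ^ multiplicity p b \<le> (\<Sum>i<K. if p ^ i dvd b then p ^ i else 0)"
      by (simp add: multiplicity_dvd)
  qed
  also have "\<dots> = (\<Sum>i<K. \<Sum>b=1..a. if p ^ i dvd b then p ^ i else 0)" by (rule sum.swap)
  also have "\<dots> = (\<Sum>i<K. p ^ i * card {b\<in>{1..a}. p ^ i dvd b})"
    by (simp add: sum.If_cases Int_def mult.commute)
  also have "\<dots> \<le> (\<Sum>i<K. a)"
  proof (rule sum_mono)
    fix i
    have "p ^ i * card {b\<in>{1..a}. p ^ i dvd b} \<le> p ^ i * (a div p ^ i)"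
      using card [of "p ^ i"] p by (simp add: prime_gt_0_nat)
    then show "p ^ i * card {b\<in>{1..a}. p ^ i dvd b} \<le> a"
      using times_div_less_eq_dividend [of "p ^ i" a] by linarith
  qed
  finally show ?thesis by simp
qed

text \<open>Each factor is \<open>(1 + Y) ^ (b + h)\<close>, of order 0, times
  \<open>(1 + Y) ^ (a - b) - 1\<close>; so the shift \<open>h\<close> does not affect the
  order.\<close>

lemma ex_order_mod_prod_diff:
  fixes p :: nat
  assumes p: "prime p" and a: "a < p ^ K"
  shows "\<exists>w\<le>K * a. order_mod (int p) (\<Prod>b<a. [:1, 1:] ^ (a + h) - [:1, 1:] ^ (b + h)) w"
proof (intro exI conjI)
  let ?w = "\<Sum>b<a. 0 + p ^ multiplicity p (a - b)"
  have "(\<Sum>b<a. p ^ multiplicity p (a - b)) = (\<Sum>b=1..a. p ^ multiplicity p b)"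
    by (rule sum.reindex_bij_witness [of _ "\<lambda>b. a - b" "\<lambda>b. a - b"]) auto
  then show "?w \<le> K * a" using sum_prime_power_multiplicity_le [OF p a] by simp
  have pi: "prime (int p)" using p by simp
  show "order_mod (int p) (\<Prod>b<a. [:1, 1:] ^ (a + h) - [:1, 1:] ^ (b + h)) ?w"
  proof (rule order_mod_prod [OF pi])
    fix b assume b: "b \<in> {..<a}"
    have "a + h = (b + h) + (a - b)" using b by simp
    then have "[:1, 1 :: int:] ^ (a + h) = [:1, 1:] ^ (b + h) * [:1, 1:] ^ (a - b)"
      by (metis power_add)
    then have "[:1, 1 :: int:] ^ (a + h) - [:1, 1:] ^ (b + h) = [:1, 1:] ^ (b + h) * ([:1, 1:] ^ (a - b) - 1)"
      by (simp add: right_diff_distrib)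
    moreover have "order_mod (int p) ([:1, 1:] ^ (b + h) * ([:1, 1:] ^ (a - b) - 1)) (0 + p ^ multiplicity p (a - b))"
      using b by (intro order_mod_mult pi order_mod_one_plus_power order_mod_one_plus_power_diff_one p) simp
    ultimately show "order_mod (int p) ([:1, 1:] ^ (a + h) - [:1, 1:] ^ (b + h)) (0 + p ^ multiplicity p (a - b))"
      by metis
  qed
qed

text \<open>The test vectors: an integer combination of evaluations in \<open>v\<close> realises, for every \<open>u\<close>
  at once, the polynomial \<open>Y ^ s * (\<Prod>j\<in>J. \<Prod>b<a j. (1 + Y) ^ (u j + h j) - (1 + Y) ^ (b + h j))\<close>. It
  vanishes unless \<open>u \<ge> a\<close>, and for \<open>u = a\<close> its order modulo p is \<open>s\<close> plus at most \<open>K * sum a J\<close>.\<close>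

lemma binomial_family_independent_mod:
  fixes p K :: nat and J :: "'j set" and h :: "'j \<Rightarrow> nat"
    and I :: "(('j \<Rightarrow> nat) \<times> nat) set" and c :: "('j \<Rightarrow> nat) \<times> nat \<Rightarrow> int"
  assumes p: "prime p" and J: "finite J" and I: "finite I"
    and ext: "\<And>u e. (u, e) \<in> I \<Longrightarrow> u \<in> extensional J"
    and bound: "\<And>u e j. (u, e) \<in> I \<Longrightarrow> j \<in> J \<Longrightarrow> u j < p ^ K"
    and ord: "\<And>u e. (u, e) \<in> I \<Longrightarrow> K * (\<Sum>j\<in>J. u j) \<le> e"
    and rel: "\<And>v :: nat \<times> ('j \<Rightarrow> nat).
      int p dvd (\<Sum>i\<in>I. c i * int ((fst v + (\<Sum>j\<in>J. (fst i j + h j) * snd v j)) choose snd i))"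
    and i: "i \<in> I"
  shows "int p dvd c i"
proof (rule ccontr)
  assume ni: "\<not> int p dvd c i"
  have pi: "prime (int p)" using p by simp
  let ?Y = "[:1, 1 :: int:]"
  define s where "s u v = (\<Sum>j\<in>J. (u j + h j) * v j)" for u v :: "'j \<Rightarrow> nat"
  define L where "L P = (\<Sum>i\<in>I. c i * coeff (P (fst i)) (snd i))" for P :: "('j \<Rightarrow> nat) \<Rightarrow> int poly"
  \<comment> \<open>Relations are demanded for all multiples by \<open>?Y ^ (x + s u v)\<close>.
    Multiplying by \<open>?Y\<close> or \<open>?Y ^ (u j + h j)\<close> then merely changes
    \<open>x\<close> or \<open>v j\<close>, so \<open>good\<close> is closed under the factors of
    the test vectors.\<close>
  define good where "good P \<longleftrightarrow> (\<forall>x v. int p dvd L (\<lambda>u. ?Y ^ (x + s u v) * P u))" for P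
  have L_diff: "L (\<lambda>u. P u - Q u) = L P - L Q" for P Q
    by (simp add: L_def right_diff_distrib sum_subtractf)
  have good_one: "good (\<lambda>u. 1)"
    unfolding good_def L_def s_def mult_1_right coeff_one_plus_power using rel [of "(x, v)" for x v] by simp
  have good_diff: "good (\<lambda>u. P u - Q u)" if "good P" "good Q" for P Q
    using that unfolding good_def right_diff_distrib L_diff by (simp add: dvd_diff)
  have good_shift0: "good (\<lambda>u. P u * ?Y ^ y)" if "good P" for P y
    unfolding good_def
  proof (intro allI)
    fix x v
    have "int p dvd L (\<lambda>u. ?Y ^ ((x + y) + s u v) * P u)" using that unfolding good_def by blast
    then show "int p dvd L (\<lambda>u. ?Y ^ (x + s u v) * (P u * ?Y ^ y))"
      by (simp add: power_add ac_simps)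
  qed
  have good_shift: "good (\<lambda>u. P u * ?Y ^ (u j + h j))" if "good P" "j \<in> J" for P j
    unfolding good_def
  proof (intro allI)
    fix x v
    have "s u (v(j := Suc (v j))) = s u v + (u j + h j)" for u
      unfolding s_def using J that(2) by (simp add: sum.remove [of J j])
    moreover have "int p dvd L (\<lambda>u. ?Y ^ (x + s u (v(j := Suc (v j)))) * P u)"
      using that unfolding good_def by blast
    ultimately show "int p dvd L (\<lambda>u. ?Y ^ (x + s u v) * (P u * ?Y ^ (u j + h j)))"
      by (simp add: power_add ac_simps)
  qed
  have good_factor: "good (\<lambda>u. P u * (?Y ^ (u j + h j) - ?Y ^ y))" if "good P" "j \<in> J" for P j y
    using good_diff [OF good_shift [OF that] good_shift0 [OF that(1), of y]] by (simp add: right_diff_distrib)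
  have good_Y: "good (\<lambda>u. P u * [:0, 1:])" if "good P" for P
  proof -
    have "P u * [:0, 1:] = P u * ?Y ^ 1 - P u * ?Y ^ 0" for u
      by (simp add: algebra_simps)
    then show ?thesis using good_diff [OF good_shift0 [OF that, of 1] good_shift0 [OF that, of 0]] by simp
  qed
  have good_Y_power: "good (\<lambda>u. P u * [:0, 1:] ^ m)" if "good P" for P m
  proof (induction m)
    case (Suc m)
    then show ?case using good_Y [OF Suc] by (simp add: mult.assoc mult.commute [of "[:0, 1:]"])
  qed (use that in simp)
  have good_prod1: "good (\<lambda>u. P u * (\<Prod>b<m. ?Y ^ (u j + h j) - ?Y ^ (b + h j)))" if "good P" "j \<in> J" for P j m
  proof (induction m)
    case (Suc m)
    then show ?case using good_factor [OF Suc that(2), of "m + h j"] by (simp add: mult.assoc)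
  qed (use that in simp)
  have good_prod: "good (\<lambda>u. \<Prod>j\<in>J'. \<Prod>b<a j. ?Y ^ (u j + h j) - ?Y ^ (b + h j))" if "J' \<subseteq> J" for J' a
    using finite_subset [OF that J] that
  proof (induction J' rule: finite_induct)
    case (insert j J')
    then have "good (\<lambda>u. (\<Prod>j\<in>J'. \<Prod>b<a j. ?Y ^ (u j + h j) - ?Y ^ (b + h j)) *
        (\<Prod>b<a j. ?Y ^ (u j + h j) - ?Y ^ (b + h j)))"
      by (intro good_prod1) auto
    then show ?case using insert.hyps by (simp add: mult.commute)
  qed (simp add: good_one)
  \<comment> \<open>Among the \<open>u\<close> carrying a coefficient nonzero modulo p, take
    \<open>a\<close> of maximal sum. Any other such \<open>u\<close> is below \<open>a\<close> in
    some coordinate, where the product built from \<open>a\<close> has a zero factor.\<close>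
  define U where "U = fst ` {i\<in>I. \<not> int p dvd c i}"
  have "fst i \<in> U" using i ni by (simp add: U_def)
  then have "finite U" "U \<noteq> {}" using I by (auto simp: U_def)
  then obtain a where a: "a \<in> U" "\<And>u. u \<in> U \<Longrightarrow> sum u J \<le> sum a J"
    using Max_in [of "(\<lambda>u. sum u J) ` U"] Max_ge [of "(\<lambda>u. sum u J) ` U"]
    by (metis (no_types, lifting) finite_imageI image_eqI image_iff image_is_empty)
  define E where "E = {e. (a, e) \<in> I \<and> \<not> int p dvd c (a, e)}"
  have "E \<subseteq> snd ` I" by (force simp: E_def)
  then have E: "finite E" "E \<noteq> {}" using I a(1) finite_subset by (auto simp: U_def E_def)
  define e where "e = Max E"
  have "e \<in> E" using Max_in [OF E] by (simp add: e_def)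
  then have e: "(a, e) \<in> I" "\<not> int p dvd c (a, e)" by (simp_all add: E_def)
  have e_max: "int p dvd c (a, e')" if "(a, e') \<in> I" "e < e'" for e'
  proof (rule ccontr)
    assume "\<not> ?thesis"
    then have "e' \<in> E" using that by (simp add: E_def)
    then have "e' \<le> e" unfolding e_def by (rule Max_ge [OF E(1)])
    then show False using that by simp
  qed
  have "\<exists>w\<le>K * a j. order_mod (int p) (\<Prod>b<a j. ?Y ^ (a j + h j) - ?Y ^ (b + h j)) w" if "j \<in> J" for j
    using bound [OF e(1) that] by (rule ex_order_mod_prod_diff [OF p])
  then obtain w where w: "\<And>j. j \<in> J \<Longrightarrow> w j \<le> K * a j"
    "\<And>j. j \<in> J \<Longrightarrow> order_mod (int p) (\<Prod>b<a j. ?Y ^ (a j + h j) - ?Y ^ (b + h j)) (w j)" by metis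
  have "sum w J \<le> e"
  proof -
    have "sum w J \<le> (\<Sum>j\<in>J. K * a j)" by (intro sum_mono w)
    then show ?thesis using ord [OF e(1)] by (simp add: sum_distrib_left)
  qed
  \<comment> \<open>The power of Y pads the order at \<open>a\<close> to exactly \<open>e\<close>.
    For \<open>u = a\<close>, indices below \<open>e\<close> are killed by the coefficients of
    \<open>R a\<close> and indices above \<open>e\<close> by the maximality of \<open>e\<close>;
    only the pair \<open>(a, e)\<close> survives.\<close>
  define R where "R u = (\<Prod>j\<in>J. \<Prod>b<a j. ?Y ^ (u j + h j) - ?Y ^ (b + h j)) * [:0, 1:] ^ (e - sum w J)" for u
  have "good R" unfolding R_def by (intro good_Y_power good_prod) simp
  then have "int p dvd L (\<lambda>u. ?Y ^ (0 + s u (\<lambda>_. 0)) * R u)" unfolding good_def by blast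
  then have dvd: "int p dvd L R" by (simp add: s_def)
  have ordX: "order_mod (int p) ([:0, 1:] ^ m) m" for m
    using prime_gt_1_nat [OF p] by (simp add: order_mod_def monom_altdef [of 1, simplified, symmetric])
  have "order_mod (int p) (R a) (sum w J + (e - sum w J))"
    unfolding R_def by (intro order_mod_mult order_mod_prod pi w ordX)
  then have Ra: "order_mod (int p) (R a) e" using \<open>sum w J \<le> e\<close> by simp
  have other: "int p dvd c i' * coeff (R (fst i')) (snd i')" if i': "i' \<in> I - {(a, e)}" for i'
  proof (cases "int p dvd c i'")
    case False
    obtain u e' where ue: "i' = (u, e')" by (cases i')
    have u: "u \<in> U" unfolding U_def using False i' ue by force
    show ?thesis
    proof (cases "u = a")
      case True
      then have "e' < e" using e_max [of e'] False i' ue by force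
      then show ?thesis using Ra ue True by (simp add: order_mod_def)
    next
      case False
      have "\<exists>j\<in>J. u j < a j"
      proof (rule ccontr)
        assume "\<not> ?thesis"
        then have ge: "\<And>j. j \<in> J \<Longrightarrow> a j \<le> u j" by (auto simp: not_less)
        have "sum a J = sum u J" using a(2) [OF u] sum_mono [of J a u] ge by (intro antisym) auto
        then have "a j = u j" if "j \<in> J" for j
          using sum_strict_mono_ex1 [OF J, of a u] ge that by (metis le_neq_implies_less less_irrefl)
        moreover have "u \<in> extensional J" "a \<in> extensional J" using ext i' ue e(1) by blast+
        ultimately have "u = a" by (metis extensionalityI)
        then show False using False by simp
      qed
      then obtain j where j: "j \<in> J" "u j < a j" by blast
      have "(\<Prod>b<a j. ?Y ^ (u j + h j) - ?Y ^ (b + h j)) = 0"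
        using j by (intro prod_zero) auto
      then have "(\<Prod>j\<in>J. \<Prod>b<a j. ?Y ^ (u j + h j) - ?Y ^ (b + h j)) = 0"
        using j J by (intro prod_zero) auto
      then have "R u = 0" by (simp add: R_def)
      then show ?thesis using ue by simp
    qed
  qed simp
  have "L R = c (a, e) * coeff (R a) e + (\<Sum>i'\<in>I - {(a, e)}. c i' * coeff (R (fst i')) (snd i'))"
    unfolding L_def using I e(1) by (subst sum.remove [where x = "(a, e)"]) auto
  moreover have "int p dvd (\<Sum>i'\<in>I - {(a, e)}. c i' * coeff (R (fst i')) (snd i'))"
    by (intro dvd_sum other)
  ultimately have "int p dvd c (a, e) * coeff (R a) e" using dvd by (simp add: dvd_add_left_iff)
  then show False using e(2) Ra pi by (simp add: prime_dvd_mult_iff order_mod_def)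
qed

subsection \<open>The chart of directions with a coordinate equal to one\<close>

definition simplex :: "'j set \<Rightarrow> nat \<Rightarrow> ('j \<Rightarrow> nat) set"
  where "simplex J N = {\<beta> \<in> J \<rightarrow>\<^sub>E UNIV. sum \<beta> J < N}"

lemma finite_simplex: "finite J \<Longrightarrow> finite (simplex J N)"
proof (rule finite_subset)
  assume J: "finite J"
  show "simplex J N \<subseteq> J \<rightarrow>\<^sub>E {..<N}"
  proof
    fix \<beta> assume b: "\<beta> \<in> simplex J N"
    have "\<beta> j < N" if "j \<in> J" for j
      using member_le_sum [of j J \<beta>] that J b by (simp add: simplex_def)
    then show "\<beta> \<in> J \<rightarrow>\<^sub>E {..<N}" using b by (auto simp: simplex_def PiE_iff)
  qed
  show "finite (J \<rightarrow>\<^sub>E {..<N})" using J by (intro finite_PiE) auto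
qed

lemma card_simplex:
  fixes J :: "'j set"
  assumes "finite J"
  shows "card (simplex J (Suc N)) = (N + card J) choose card J"
  using assms
proof (induction J arbitrary: N rule: finite_induct)
  case empty
  have "simplex {} (Suc N) = {\<lambda>_ :: 'j. undefined :: nat}" by (auto simp: simplex_def)
  then show ?case by simp
next
  case (insert j J)
  let ?f = "\<lambda>(b, \<beta>). \<beta>(j := b)"
  have eq: "simplex (insert j J) (Suc N) = ?f ` (SIGMA b:{..N}. simplex J (Suc (N - b)))"
  proof (intro equalityI subsetI)
    fix \<beta> assume b: "\<beta> \<in> simplex (insert j J) (Suc N)"
    let ?r = "restrict \<beta> J"
    have "sum \<beta> J + \<beta> j \<le> N" using b insert.hyps by (simp add: simplex_def)
    moreover have "sum ?r J = sum \<beta> J" by (rule sum.cong) auto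
    moreover have "\<beta> = ?f (\<beta> j, ?r)"
      using b insert.hyps by (auto simp: simplex_def PiE_def extensional_def fun_eq_iff)
    ultimately show "\<beta> \<in> ?f ` (SIGMA b:{..N}. simplex J (Suc (N - b)))"
      by (intro image_eqI [where x = "(\<beta> j, ?r)"]) (auto simp: simplex_def)
  next
    fix \<beta> assume "\<beta> \<in> ?f ` (SIGMA b:{..N}. simplex J (Suc (N - b)))"
    then obtain b r where br: "\<beta> = r(j := b)" "b \<le> N" "r \<in> simplex J (Suc (N - b))" by auto
    have "sum \<beta> J = sum r J" using insert.hyps br(1) by (intro sum.cong) auto
    then show "\<beta> \<in> simplex (insert j J) (Suc N)"
      using br insert.hyps by (auto simp: simplex_def PiE_def extensional_def)
  qed
  have inj: "inj_on ?f (SIGMA b:{..N}. simplex J (Suc (N - b)))"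
  proof (rule inj_onI, clarify)
    fix b r b' r'
    assume r: "r \<in> simplex J (Suc (N - b))" "r' \<in> simplex J (Suc (N - b'))" and e: "r(j := b) = r'(j := b')"
    have "b = b'" using e by (metis fun_upd_same)
    moreover have "r x = r' x" for x
      using fun_cong [OF e, of x] r insert.hyps
      by (cases "x = j") (auto simp: simplex_def PiE_def extensional_def)
    ultimately show "b = b' \<and> r = r'" by auto
  qed
  have "card (simplex (insert j J) (Suc N)) = (\<Sum>b\<le>N. card (simplex J (Suc (N - b))))"
    unfolding eq card_image [OF inj] using finite_simplex [OF insert.hyps(1)] by (simp add: card_SigmaI)
  also have "\<dots> = (\<Sum>b\<le>N. (N - b + card J) choose card J)" by (simp add: insert.IH)
  also have "\<dots> = (\<Sum>b\<le>N. (card J + b) choose card J)"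
    by (rule sum.reindex_bij_witness [of _ "\<lambda>b. N - b" "\<lambda>b. N - b"]) (auto simp: add.commute)
  also have "\<dots> = (card J + N + 1) choose (card J + 1)" by (rule choose_rising_sum)
  finally show ?case using insert.hyps by (simp add: add.commute)
qed

lemma power_le_fact_choose: "D ^ n \<le> fact n * ((D - 1 + n) choose n)" if "D \<ge> 1"
proof (induction n)
  case (Suc n)
  have "D ^ Suc n \<le> (D + n) * (fact n * ((D - 1 + n) choose n))"
    using mult_mono [OF le_add1 [of D n] Suc] by simp
  also have "\<dots> = fact n * ((D + n) * ((D - 1 + n) choose n))" by simp
  also have "(D + n) * ((D - 1 + n) choose n) = Suc n * ((D + n) choose Suc n)"
    using Suc_times_binomial [of n "D - 1 + n"] that by simp
  finally show ?case using that by (simp add: algebra_simps)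
qed simp

text \<open>The left side is the product of \<open>M - 1 + i\<close> for
  \<open>i = 1, ..., n\<close>, and each factor is below \<open>2 * M\<close> because
  \<open>n \<le> M\<close>. This is the only origin of the 2 in the constant.\<close>

lemma fact_choose_le_power: "fact n * ((M - 1 + n) choose n) \<le> (2 * M) ^ n" if "n \<le> M"
  using that
proof (induction n)
  case (Suc n)
  then have M: "M \<ge> 1" by simp
  have "Suc n * ((M + n) choose Suc n) = (M + n) * ((M - 1 + n) choose n)"
    using Suc_times_binomial [of n "M - 1 + n"] M by simp
  moreover have "fact (Suc n) * ((M - 1 + Suc n) choose Suc n) = fact n * (Suc n * ((M + n) choose Suc n))"
    using M by (simp add: algebra_simps)
  ultimately have "fact (Suc n) * ((M - 1 + Suc n) choose Suc n) = (M + n) * (fact n * ((M - 1 + n) choose n))"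
    by (simp only: mult.left_commute)
  also have "\<dots> \<le> (2 * M) * (2 * M) ^ n" using Suc by (intro mult_mono) auto
  finally show ?case by simp
qed simp

text \<open>A linear functional on polynomials is recorded by its values on the monomials
  \<open>y ^ v\<close>. This one applies the Euler operators \<open>y j * d/dy j\<close>, each
  \<open>\<beta> j\<close> times, and evaluates at the point with coordinates
  \<open>z ^ x j\<close>.\<close>

definition exp_monom :: "complex \<Rightarrow> 'j set \<Rightarrow> ('j \<Rightarrow> nat) \<Rightarrow> ('j \<Rightarrow> nat) \<Rightarrow> ('j \<Rightarrow> nat) \<Rightarrow> complex"
  where "exp_monom z J x \<beta> v = z ^ (\<Sum>j\<in>J. x j * v j) * (\<Prod>j\<in>J. of_nat (v j) ^ \<beta> j)"

lemma mult_coordinate_in_span: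
  assumes J: "finite J" "j \<in> J" and f: "f \<in> fun_vs.span (exp_monom z J x ` simplex J N)"
  shows "(\<lambda>v. of_nat (v j) * f v) \<in> fun_vs.span (exp_monom z J x ` simplex J (Suc N))"
  using f
proof (induction rule: fun_vs.span_induct_alt)
  case base
  show ?case using fun_vs.span_zero by (simp add: zero_fun_def)
next
  case (step c g f)
  then obtain \<beta> where \<beta>: "\<beta> \<in> simplex J N" "g = exp_monom z J x \<beta>" by auto
  have "(\<Prod>i\<in>J. of_nat (v i) ^ (\<beta>(j := Suc (\<beta> j))) i) = (of_nat (v j) :: complex) * (\<Prod>i\<in>J. of_nat (v i) ^ \<beta> i)" for v
    using J by (simp add: prod.remove [of J j])
  then have "(\<lambda>v. of_nat (v j) * g v) = exp_monom z J x (\<beta>(j := Suc (\<beta> j)))"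
    unfolding \<beta>(2) exp_monom_def by (simp add: fun_eq_iff)
  moreover have "\<beta>(j := Suc (\<beta> j)) \<in> simplex J (Suc N)"
    using \<beta>(1) J by (auto simp: simplex_def PiE_def extensional_def sum.remove [of J j])
  ultimately have "(\<lambda>v. of_nat (v j) * g v) \<in> fun_vs.span (exp_monom z J x ` simplex J (Suc N))"
    by (auto intro: fun_vs.span_base)
  then have "(\<lambda>v. c * (of_nat (v j) * g v)) + (\<lambda>v. of_nat (v j) * f v) \<in> fun_vs.span (exp_monom z J x ` simplex J (Suc N))"
    by (intro fun_vs.span_add fun_vs.span_scale step.IH)
  then show ?case by (simp add: plus_fun_def algebra_simps)
qed

text \<open>A form of the chain rule: the i-th derivative along a monomial curve uses partial
  derivatives of order at most \<open>i\<close>, since a binomial coefficient of a linear form in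
  \<open>v\<close> is a polynomial of degree at most \<open>i\<close> in \<open>v\<close>.\<close>

lemma choose_linear_in_span:
  assumes J: "finite J"
  shows "(\<lambda>v. of_nat ((\<Sum>j\<in>J. d j * v j) choose i) * z ^ (\<Sum>j\<in>J. x j * v j))
    \<in> fun_vs.span (exp_monom z J x ` simplex J (Suc i))"
proof (induction i)
  case 0
  let ?\<beta> = "\<lambda>j\<in>J. 0 :: nat"
  have "(\<lambda>v. of_nat ((\<Sum>j\<in>J. d j * v j) choose 0) * z ^ (\<Sum>j\<in>J. x j * v j)) = exp_monom z J x ?\<beta>"
    by (simp add: fun_eq_iff exp_monom_def)
  moreover have "?\<beta> \<in> simplex J (Suc 0)" by (simp add: simplex_def)
  ultimately show ?case by (auto intro: fun_vs.span_base)
next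
  case (Suc i)
  define s where "s v = (\<Sum>j\<in>J. d j * v j)" for v
  define f where "f v = of_nat (s v choose i) * z ^ (\<Sum>j\<in>J. x j * v j)" for v
  let ?S = "\<lambda>i. fun_vs.span (exp_monom z J x ` simplex J (Suc i))"
  have f: "f \<in> ?S i" using Suc.IH by (simp add: f_def [abs_def] s_def)
  have mono: "?S i \<subseteq> ?S (Suc i)" by (intro fun_vs.span_mono image_mono) (auto simp: simplex_def)
  have "(\<Sum>j\<in>J. (\<lambda>v. of_nat (d j) * (of_nat (v j) * f v))) - (\<lambda>v. of_nat i * f v) \<in> ?S (Suc i)"
    using f mono by (intro fun_vs.span_diff fun_vs.span_sum fun_vs.span_scale mult_coordinate_in_span J) auto
  then have "(\<lambda>v. (1 / of_nat (Suc i)) * ((\<Sum>j\<in>J. (\<lambda>v. of_nat (d j) * (of_nat (v j) * f v))) - (\<lambda>v. of_nat i * f v)) v) \<in> ?S (Suc i)"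
    by (rule fun_vs.span_scale)
  moreover have "(1 / of_nat (Suc i)) * ((\<Sum>j\<in>J. (\<lambda>v. of_nat (d j) * (of_nat (v j) * f v))) - (\<lambda>v. of_nat i * f v)) v
     = of_nat (s v choose Suc i) * z ^ (\<Sum>j\<in>J. x j * v j)" for v
  proof -
    have choose: "(of_nat (s v) - of_nat i) * of_nat (s v choose i) = (of_nat (Suc i) * of_nat (s v choose Suc i) :: complex)"
    proof (cases "i \<le> s v")
      case True
      have "(s v - i) * (s v choose i) = Suc i * (s v choose Suc i)"
        using binomial_absorb_comp [of "s v" i] Suc_times_binomial [of i "s v - 1"] by (cases "s v") auto
      then show ?thesis using True by (metis of_nat_diff of_nat_mult)
    qed (simp add: not_le binomial_eq_0)
    have "((\<Sum>j\<in>J. (\<lambda>v. of_nat (d j) * (of_nat (v j) * f v))) - (\<lambda>v. of_nat i * f v)) v = (of_nat (s v) - of_nat i) * f v"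
      by (simp add: sum_fun_apply s_def left_diff_distrib sum_distrib_right mult.assoc)
    also have "\<dots> = of_nat (Suc i) * (of_nat (s v choose Suc i) * z ^ (\<Sum>j\<in>J. x j * v j))"
      unfolding f_def mult.assoc [symmetric] choose ..
    finally show ?thesis by (simp del: of_nat_Suc)
  qed
  ultimately show ?case by (simp only: s_def)
qed


text \<open>The pair \<open>(u, e)\<close> stands for the e-th divided difference of a polynomial along the curve in the
  direction with coordinate 1 at \<open>j0\<close> and \<open>u j + g j\<close> elsewhere.\<close>

lemma card_translate_le:
  fixes p k K M q :: nat and J :: "'j set" and j0 :: 'j and S :: "('j \<Rightarrow> nat) set"
    and g :: "'j \<Rightarrow> nat" and T :: "('j \<Rightarrow> nat) \<Rightarrow> nat set"
  assumes p: "prime p" and k: "k \<ge> 1" and q: "q = p ^ k" and J: "finite J" "j0 \<notin> J" and S: "finite S"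
    and T: "\<And>h. h \<in> J \<rightarrow>\<^sub>E {..<q} \<Longrightarrow> T h \<subseteq> {..<q}"
    and lines: "\<And>h. h \<in> J \<rightarrow>\<^sub>E {..<q} \<Longrightarrow> \<exists>a. \<forall>t\<in>T h. \<exists>x\<in>S.
      [a j0 + t = x j0] (mod q) \<and> (\<forall>j\<in>J. [a j + t * h j = x j] (mod q))"
  shows "card {(u, e). u \<in> J \<rightarrow>\<^sub>E {..<p ^ K} \<and> K * sum u J \<le> e \<and>
      e < M * card (T (\<lambda>j\<in>J. (u j + g j) mod q))} \<le> card S * card (simplex (insert j0 J) M)"
proof -
  \<comment> \<open>Exponent vectors \<open>u\<close> with equal residues share a line but give
    different curves; this lets \<open>u\<close> range up to \<open>p ^ K\<close>, well beyond
    \<open>q\<close>.\<close>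
  define rd where "rd u = (\<lambda>j\<in>J. (u j + g j) mod q)" for u :: "'j \<Rightarrow> nat"
  define I where "I = {(u, e). u \<in> J \<rightarrow>\<^sub>E {..<p ^ K} \<and> K * sum u J \<le> e \<and> e < M * card (T (rd u))}"
  have q0: "q > 0" using p q by (simp add: prime_gt_0_nat)
  have rd: "rd u \<in> J \<rightarrow>\<^sub>E {..<q}" for u using q0 by (simp add: rd_def)
  have finT: "finite (T (rd u))" for u by (rule finite_subset [OF T [OF rd]]) simp
  have cardT: "card (T (rd u)) \<le> q" for u using card_mono [OF _ T [OF rd]] by simp
  have finI: "finite I"
  proof (rule finite_subset)
    show "I \<subseteq> (J \<rightarrow>\<^sub>E {..<p ^ K}) \<times> {..<M * q}"
      using cardT by (auto simp: I_def intro: less_le_trans)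
    show "finite ((J \<rightarrow>\<^sub>E {..<p ^ K}) \<times> {..<M * q})" using J by (intro finite_cartesian_product finite_PiE) auto
  qed
  obtain z :: complex where z: "z ^ q = 1" "inj_on (\<lambda>t. z ^ t) {..<q}"
    and zp: "\<And>g. eval_int g z = 0 \<Longrightarrow> int p dvd poly g 1"
    using ex_root_of_unity_specializing [OF p k] q by auto
  have z0: "z \<noteq> 0" using z(1) q0 by (metis power_0_left neq0_conv zero_neq_one)
  have zmod: "z ^ x = z ^ y" if "[x = y] (mod q)" for x y
  proof -
    have "z ^ x = z ^ (x mod q)" for x
      using z(1) by (metis mod_mult_div_eq mult_1_right power_add power_mult power_one)
    then show ?thesis using that by (metis cong_def)
  qed
  define a where "a u = (SOME a. \<forall>t\<in>T (rd u). \<exists>x\<in>S.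
      [a j0 + t = x j0] (mod q) \<and> (\<forall>j\<in>J. [a j + t * rd u j = x j] (mod q)))" for u
  have a: "\<exists>x\<in>S. [a u j0 + t = x j0] (mod q) \<and> (\<forall>j\<in>J. [a u j + t * rd u j = x j] (mod q))"
    if "t \<in> T (rd u)" for t u
    using someI_ex [OF lines [OF rd [of u]]] that unfolding a_def by blast
  define f where "f u = (SOME f. bij_betw f {0..<card (T (rd u))} (T (rd u)))" for u
  have f: "bij_betw (f u) {0..<card (T (rd u))} (T (rd u))" for u
    unfolding f_def by (rule someI_ex [OF ex_bij_betw_nat_finite [OF finT]])
  define J' where "J' = insert j0 J"
  have J': "finite J'" using J by (simp add: J'_def)
  define d where "d u j = (if j = j0 then 1 else u j + g j)" for u j
  define s where "s u v = (\<Sum>j\<in>J'. d u j * v j)" for u v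
  have s_eq: "s u v = v j0 + (\<Sum>j\<in>J. (u j + g j) * v j)" for u v
  proof -
    have "(\<Sum>j\<in>J. d u j * v j) = (\<Sum>j\<in>J. (u j + g j) * v j)"
      using J by (intro sum.cong) (auto simp: d_def)
    then show ?thesis using J by (simp add: s_def J'_def d_def)
  qed
  \<comment> \<open>The monomial carries the coefficients of the curve. Each node
    \<open>z ^ t\<close> is repeated \<open>M\<close> times, so that differences of order below
    \<open>M * card T\<close> need only derivatives of order below \<open>M\<close>. At 1 in place
    of \<open>z\<close> all nodes merge.\<close>
  define \<psi> where "\<psi> i v = (monom 1 (\<Sum>j\<in>J'. a (fst i) j * v j) *
      chs (\<lambda>l. monom 1 (f (fst i) (l div M))) (snd i) (s (fst i) v) :: int poly)" for i :: "('j \<Rightarrow> nat) \<times> nat" and v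
  define \<Theta> where "\<Theta> = (\<lambda>(x, \<beta>). exp_monom z J' x \<beta>) ` (S \<times> simplex J' M)"
  have "card I \<le> card \<Theta>"
  proof (rule card_le_of_independent_mod [of "int p" z I \<psi>])
    show "prime (int p)" using p by simp
    show "finite \<Theta>" unfolding \<Theta>_def using S finite_simplex [OF J'] by simp
    show "int p dvd c i" if rel: "\<And>v. int p dvd (\<Sum>i\<in>I. c i * poly (\<psi> i v) 1)" and i: "i \<in> I" for c i
    proof (rule binomial_family_independent_mod [OF p J(1) finI, of K c g])
      fix v :: "nat \<times> ('j \<Rightarrow> nat)"
      have "poly (\<psi> i w) 1 = int (s (fst i) w choose snd i)" for i w
        by (simp add: \<psi>_def poly_monom poly_chs chs_one)
      moreover have "s u ((snd v)(j0 := fst v)) = fst v + (\<Sum>j\<in>J. (u j + g j) * snd v j)" for u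
      proof -
        have "(\<Sum>j\<in>J. (u j + g j) * ((snd v)(j0 := fst v)) j) = (\<Sum>j\<in>J. (u j + g j) * snd v j)"
          using J by (intro sum.cong) auto
        then show ?thesis by (simp add: s_eq)
      qed
      ultimately show "int p dvd (\<Sum>i\<in>I. c i * int ((fst v + (\<Sum>j\<in>J. (fst i j + g j) * snd v j)) choose snd i))"
        using rel [of "(snd v)(j0 := fst v)"] by simp
    qed (use i in \<open>auto simp: I_def PiE_iff\<close>)
    show "(\<lambda>v. eval_int (\<psi> i v) z) \<in> fun_vs.span \<Theta>" if i: "i \<in> I" for i
    proof -
      obtain u e where ue: "i = (u, e)" by (cases i)
      have e: "e < M * card (T (rd u))" using i ue by (simp add: I_def)
      have M: "M > 0" using e by (cases M) auto
      define y where "y l = z ^ f u (l div M)" for l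
      define E where "E = {exp_poly x i | x i. i < card {l. l \<le> e \<and> y l = x}}"
      let ?tw = "\<lambda>r v. z ^ (\<Sum>j\<in>J'. a u j * v j) * r (s u v)"
      have "?tw r \<in> fun_vs.span \<Theta>" if "r \<in> fun_vs.span E" for r
        using that
      proof (induction rule: fun_vs.span_induct_alt)
        case base
        show ?case using fun_vs.span_zero by (simp add: zero_fun_def)
      next
        case (step c b r)
        then obtain x m where b: "b = exp_poly x m" and m: "m < card {l. l \<le> e \<and> y l = x}"
          by (auto simp: E_def)
        have "{l. l \<le> e \<and> y l = x} \<noteq> {}" using m by (metis card.empty not_less_zero)
        then obtain l where l: "l \<le> e" "y l = x" by auto
        have blk: "l' div M < card (T (rd u))" if "l' \<le> e" for l'
          using that e M by (metis le_less_trans less_mult_imp_div_less mult.commute)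
        have fT: "f u (l' div M) \<in> T (rd u)" if "l' \<le> e" for l'
          using bij_betwE [OF f [of u]] blk [OF that] by simp
        \<comment> \<open>Equal nodes lie in one block of length \<open>M\<close>, because
          \<open>f u\<close> is injective and the powers of \<open>z\<close> below \<open>q\<close>
          are distinct; this gives \<open>m < M\<close>.\<close>
        have "{l'. l' \<le> e \<and> y l' = x} \<subseteq> {l div M * M..<l div M * M + M}"
        proof
          fix l' assume l': "l' \<in> {l'. l' \<le> e \<and> y l' = x}"
          then have "z ^ f u (l' div M) = z ^ f u (l div M)" using l by (simp add: y_def)
          then have "f u (l' div M) = f u (l div M)"
            using z(2) fT [of l'] fT [of l] T [OF rd [of u]] l l' by (auto dest!: inj_onD)
          then have "l' div M = l div M"
            using bij_betw_imp_inj_on [OF f [of u]] blk [of l'] blk [of l] l l' by (auto dest!: inj_onD)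
          then have "l div M * M + l' mod M = l'" by (metis div_mult_mod_eq)
          then show "l' \<in> {l div M * M..<l div M * M + M}"
            using mod_less_divisor [OF M, of l'] unfolding atLeastLessThan_iff by (intro conjI; linarith)
        qed
        then have "card {l'. l' \<le> e \<and> y l' = x} \<le> card {l div M * M..<l div M * M + M}" by (intro card_mono) auto
        then have mM: "m < M" using m by simp
        let ?t = "f u (l div M)"
        obtain w where w: "w \<in> S" "[a u j0 + ?t = w j0] (mod q)" "\<And>j. j \<in> J \<Longrightarrow> [a u j + ?t * rd u j = w j] (mod q)"
          using a [OF fT [OF l(1)]] by blast
        \<comment> \<open>Because only exponents modulo \<open>q\<close> matter, the curve for any
          lift \<open>u j + g j\<close> of the direction meets, at the node \<open>z ^ ?t\<close>,
          the point attached to \<open>w\<close> in \<open>S\<close>.\<close>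
        have wd: "[a u j + ?t * d u j = w j] (mod q)" if "j \<in> J'" for j
        proof (cases "j = j0")
          case False
          then have j: "j \<in> J" using that by (simp add: J'_def)
          have "[a u j + ?t * (u j + g j) = a u j + ?t * rd u j] (mod q)"
            using j by (intro cong_add cong_mult cong_refl) (simp add: rd_def cong_def)
          then show ?thesis using w(3) [OF j] False by (simp add: d_def cong_trans)
        qed (use w in \<open>simp add: d_def\<close>)
        have "?tw b = (\<lambda>v. of_nat ((\<Sum>j\<in>J'. d u j * v j) choose m) * z ^ (\<Sum>j\<in>J'. w j * v j))"
        proof
          fix v
          have "z ^ (\<Sum>j\<in>J'. a u j * v j) * x ^ s u v = z ^ (\<Sum>j\<in>J'. (a u j + ?t * d u j) * v j)"
            by (simp add: l(2) [symmetric] y_def s_def power_add [symmetric] power_mult [symmetric]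
                sum_distrib_left sum.distrib algebra_simps)
          also have "\<dots> = z ^ (\<Sum>j\<in>J'. w j * v j)"
            by (intro zmod cong_sum cong_mult wd cong_refl)
          finally show "?tw b v = of_nat ((\<Sum>j\<in>J'. d u j * v j) choose m) * z ^ (\<Sum>j\<in>J'. w j * v j)"
            unfolding b exp_poly_def s_def by (simp add: mult.left_commute)
        qed
        also have "\<dots> \<in> fun_vs.span (exp_monom z J' w ` simplex J' (Suc m))"
          by (rule choose_linear_in_span [OF J'])
        also have "\<dots> \<subseteq> fun_vs.span \<Theta>"
          using w(1) mM by (intro fun_vs.span_mono) (force simp: \<Theta>_def simplex_def)
        finally have "(\<lambda>v. c * ?tw b v) + ?tw r \<in> fun_vs.span \<Theta>"
          by (intro fun_vs.span_add fun_vs.span_scale step.IH)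
        then show ?case by (simp add: plus_fun_def algebra_simps)
      qed
      moreover have "chs y e \<in> fun_vs.span E"
        unfolding E_def by (rule chs_in_span_exp_poly) (simp add: y_def z0)
      moreover have "(\<lambda>v. eval_int (\<psi> i v) z) = ?tw (chs y e)"
        by (simp add: \<psi>_def ue eval_int_chs y_def [abs_def])
      ultimately show ?thesis by simp
    qed
  qed (use zp finI in auto)
  also have "\<dots> \<le> card (S \<times> simplex J' M)"
    unfolding \<Theta>_def using S finite_simplex [OF J'] by (intro card_image_le) simp
  finally show ?thesis by (simp add: card_cartesian_product I_def rd_def J'_def)
qed

text \<open>The size is \<open>w / K\<close> rounded up, and \<open>\<beta> j0\<close> serves as the
  excess of \<open>e\<close> over its minimum. The bound \<open>w \<le> B\<close> keeps all entries
  of \<open>u\<close> in range.\<close>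

lemma card_simplex_le_card_pairs:
  fixes J :: "'j set" and K w B :: nat
  assumes J: "finite J" "j0 \<notin> J" and K: "K \<ge> 1" and w: "w \<le> B"
  shows "card (simplex (insert j0 J) ((w + K - 1) div K))
    \<le> card {(u, e). u \<in> J \<rightarrow>\<^sub>E {..<B} \<and> K * sum u J \<le> e \<and> e < w}"
proof (rule card_inj_on_le)
  let ?f = "\<lambda>\<beta>. (restrict \<beta> J, K * sum \<beta> J + \<beta> j0)"
  have res: "sum (restrict \<beta> J) J = sum \<beta> J" for \<beta> :: "'j \<Rightarrow> nat" by (rule sum.cong) auto
  show "inj_on ?f (simplex (insert j0 J) ((w + K - 1) div K))"
  proof (rule inj_onI)
    fix \<beta> \<gamma> assume mem: "\<beta> \<in> simplex (insert j0 J) ((w + K - 1) div K)" "\<gamma> \<in> simplex (insert j0 J) ((w + K - 1) div K)"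
      and e: "?f \<beta> = ?f \<gamma>"
    then have r: "restrict \<beta> J = restrict \<gamma> J" by simp
    have "sum \<beta> J = sum \<gamma> J" using r res by metis
    then have "\<beta> j0 = \<gamma> j0" using e by simp
    then have "\<beta> j = \<gamma> j" if "j \<in> insert j0 J" for j using r that by (metis insertE restrict_apply')
    then show "\<beta> = \<gamma>" using mem by (auto simp: simplex_def intro: PiE_ext)
  qed
  show "?f ` simplex (insert j0 J) ((w + K - 1) div K)
      \<subseteq> {(u, e). u \<in> J \<rightarrow>\<^sub>E {..<B} \<and> K * sum u J \<le> e \<and> e < w}"
  proof (intro image_subsetI)
    fix \<beta> assume b: "\<beta> \<in> simplex (insert j0 J) ((w + K - 1) div K)"
    have "\<beta> j0 + sum \<beta> J < (w + K - 1) div K" using b J by (simp add: simplex_def)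
    then have "Suc (\<beta> j0 + sum \<beta> J) * K \<le> w + K - 1"
      using K by (metis Suc_leI less_eq_div_iff_mult_less_eq less_le_trans zero_less_one)
    then have lt: "K * \<beta> j0 + K * sum \<beta> J < w" using K by (simp add: algebra_simps)
    have "\<beta> j0 \<le> K * \<beta> j0" using K by simp
    then have "K * sum \<beta> J + \<beta> j0 < w" using lt by linarith
    moreover have "\<beta> j < B" if "j \<in> J" for j
    proof -
      have "\<beta> j \<le> sum \<beta> J" using that J by (intro member_le_sum) auto
      also have "\<dots> \<le> K * sum \<beta> J" using K by simp
      finally show ?thesis using lt w by linarith
    qed
    ultimately show "?f \<beta> \<in> {(u, e). u \<in> J \<rightarrow>\<^sub>E {..<B} \<and> K * sum u J \<le> e \<and> e < w}"
      by (simp add: res)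
  qed
  show "finite {(u, e). u \<in> J \<rightarrow>\<^sub>E {..<B} \<and> K * sum u J \<le> e \<and> e < w}"
  proof (rule finite_subset)
    show "{(u, e). u \<in> J \<rightarrow>\<^sub>E {..<B} \<and> K * sum u J \<le> e \<and> e < w} \<subseteq> (J \<rightarrow>\<^sub>E {..<B}) \<times> {..<w}" by auto
    show "finite ((J \<rightarrow>\<^sub>E {..<B}) \<times> {..<w})" using J by (intro finite_cartesian_product finite_PiE) auto
  qed
qed

lemma sum_translate_PiE:
  fixes F :: "('j \<Rightarrow> nat) \<Rightarrow> nat" and q :: nat
  assumes J: "finite J" and q: "q > 0"
  shows "(\<Sum>g\<in>J \<rightarrow>\<^sub>E {..<q}. F (\<lambda>j\<in>J. (u j + g j) mod q)) = (\<Sum>h\<in>J \<rightarrow>\<^sub>E {..<q}. F h)"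
proof (rule sum.reindex_bij_betw)
  let ?G = "J \<rightarrow>\<^sub>E {..<q}" and ?f = "\<lambda>g. \<lambda>j\<in>J. (u j + g j) mod q"
  have fin: "finite ?G" using J by (intro finite_PiE) auto
  have into: "?f ` ?G \<subseteq> ?G" using q by auto
  have "inj_on ?f ?G"
  proof (rule inj_onI)
    fix g g' assume g: "g \<in> ?G" "g' \<in> ?G" and e: "?f g = ?f g'"
    have "g j = g' j" if j: "j \<in> J" for j
    proof -
      have "[u j + g j = u j + g' j] (mod q)" using fun_cong [OF e, of j] j by (simp add: cong_def)
      then have "[g j = g' j] (mod q)" by (simp add: cong_add_lcancel_nat)
      then show ?thesis using g j by (auto simp: cong_def PiE_iff)
    qed
    then show "g = g'" using g by (auto intro: PiE_ext)
  qed
  then show "bij_betw ?f ?G ?G" using endo_inj_surj [OF fin into] by (simp add: bij_betw_def)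
qed

text \<open>Summed over all translations, each \<open>u\<close> meets every direction
  \<open>h\<close> equally often. For fixed \<open>h\<close> the admissible pairs contain a copy of
  a simplex of size about \<open>w h / K\<close>, hence number at least \<open>w h ^ n\<close>
  divided by \<open>K ^ n * fact n\<close>. The factors \<open>fact n\<close> and
  \<open>M ^ n\<close> cancel against the count of derivatives.\<close>

lemma sum_power_chart_le:
  fixes p k l K q :: nat and J :: "'j set" and j0 :: 'j and S :: "('j \<Rightarrow> nat) set"
    and T :: "('j \<Rightarrow> nat) \<Rightarrow> nat set"
  assumes p: "prime p" and k: "k \<ge> 1" and q: "q = p ^ k" and J: "finite J" "j0 \<notin> J" and S: "finite S"
    and T: "\<And>h. h \<in> J \<rightarrow>\<^sub>E {..<q} \<Longrightarrow> T h \<subseteq> {..<q}"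
    and lines: "\<And>h. h \<in> J \<rightarrow>\<^sub>E {..<q} \<Longrightarrow> \<exists>a. \<forall>t\<in>T h. \<exists>x\<in>S.
      [a j0 + t = x j0] (mod q) \<and> (\<forall>j\<in>J. [a j + t * h j = x j] (mod q))"
    and K: "K = k + l" and n: "n = Suc (card J)" "n \<le> p ^ l"
  shows "(\<Sum>h\<in>J \<rightarrow>\<^sub>E {..<q}. card (T h) ^ n) \<le> (2 * K) ^ n * q ^ card J * card S"
proof -
  define M where "M = p ^ l"
  define G where "G = J \<rightarrow>\<^sub>E {..<q}"
  define P where "P = J \<rightarrow>\<^sub>E {..<p ^ K}"
  define J' where "J' = insert j0 J"
  define w where "w h = M * card (T h)" for h
  have q0: "q > 0" and M0: "M > 0" using p q by (simp_all add: prime_gt_0_nat M_def)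
  have J': "finite J'" "card J' = n" using J n by (simp_all add: J'_def)
  have finG: "finite G" and finP: "finite P" using J by (auto simp: G_def P_def intro: finite_PiE)
  have pairs: "card {(u, e). u \<in> P \<and> K * sum u J \<le> e \<and> e < W u} = (\<Sum>u\<in>P. W u - K * sum u J)" for W
  proof -
    have "{(u, e). u \<in> P \<and> K * sum u J \<le> e \<and> e < W u} = (SIGMA u:P. {K * sum u J..<W u})" by auto
    then show ?thesis using finP by (simp add: card_SigmaI)
  qed
  have lower: "w h ^ n \<le> K ^ n * fact n * (\<Sum>u\<in>P. w h - K * sum u J)" if h: "h \<in> G" for h
  proof -
    define D where "D = (w h + K - 1) div K"
    have K1: "K \<ge> 1" using K k by simp
    have "card (T h) \<le> q" using card_mono [OF _ T] h by (fastforce simp: G_def)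
    then have "w h \<le> p ^ l * p ^ k" unfolding w_def M_def q by simp
    \<comment> \<open>This is where \<open>K = k + l\<close> enters: \<open>p ^ K\<close> equals
      \<open>M * q\<close>, the largest possible weight of a line.\<close>
    then have wK: "w h \<le> p ^ K" by (simp add: K power_add mult.commute)
    have "w h + K - 1 < Suc D * K" unfolding D_def using K1 by (metis dividend_less_div_times less_le_trans mult_Suc add.commute zero_less_one)
    then have "w h \<le> K * D" using K1 by (simp add: algebra_simps)
    then have "w h ^ n \<le> K ^ n * D ^ n" by (metis power_mono power_mult_distrib zero_le)
    also have "D ^ n \<le> fact n * card (simplex J' D)"
    proof (cases D)
      case 0
      then show ?thesis using n by simp
    next
      case (Suc D')
      then show ?thesis using power_le_fact_choose [of D n] card_simplex [OF J'(1), of D'] J'(2) by simp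
    qed
    also have "card (simplex J' D) \<le> (\<Sum>u\<in>P. w h - K * sum u J)"
      using card_simplex_le_card_pairs [OF J K1 wK] unfolding pairs [symmetric] by (simp add: P_def J'_def D_def)
    finally show ?thesis by (simp add: mult.assoc)
  qed
  have upper: "(\<Sum>u\<in>P. w (\<lambda>j\<in>J. (u j + g j) mod q) - K * sum u J) \<le> card S * card (simplex J' M)" for g
    unfolding pairs [symmetric]
    using card_translate_le [OF p k q J S T lines, where K = K and g = g and M = M]
    by (simp only: P_def J'_def w_def)
  have tr: "(\<Sum>g\<in>G. w (\<lambda>j\<in>J. (u j + g j) mod q) - K * sum u J) = (\<Sum>h\<in>G. w h - K * sum u J)" for u
    unfolding G_def by (rule sum_translate_PiE [OF J(1) q0, of "\<lambda>h. w h - K * sum u J"])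
  have fM: "fact n * card (simplex J' M) \<le> (2 * M) ^ n"
  proof -
    obtain M' where "M = Suc M'" using M0 by (cases M) auto
    then show ?thesis using fact_choose_le_power [of n M] card_simplex [OF J'(1), of M'] J'(2) n(2) by (simp add: M_def)
  qed
  have "M ^ n * (\<Sum>h\<in>G. card (T h) ^ n) = (\<Sum>h\<in>G. w h ^ n)"
    by (simp add: w_def power_mult_distrib sum_distrib_left)
  also have "\<dots> \<le> (\<Sum>h\<in>G. K ^ n * fact n * (\<Sum>u\<in>P. w h - K * sum u J))" by (rule sum_mono) (rule lower)
  also have "\<dots> = K ^ n * fact n * (\<Sum>u\<in>P. \<Sum>h\<in>G. w h - K * sum u J)"
    unfolding sum_distrib_left [symmetric] by (subst sum.swap) simp
  also have "\<dots> = K ^ n * fact n * (\<Sum>u\<in>P. \<Sum>g\<in>G. w (\<lambda>j\<in>J. (u j + g j) mod q) - K * sum u J)"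
    unfolding tr ..
  also have "\<dots> = K ^ n * fact n * (\<Sum>g\<in>G. \<Sum>u\<in>P. w (\<lambda>j\<in>J. (u j + g j) mod q) - K * sum u J)"
    by (subst sum.swap) simp
  also have "\<dots> \<le> K ^ n * fact n * (\<Sum>g\<in>G. card S * card (simplex J' M))"
    by (intro mult_left_mono sum_mono upper) simp
  also have "\<dots> = K ^ n * card G * card S * (fact n * card (simplex J' M))" by simp
  also have "\<dots> \<le> K ^ n * card G * card S * (2 * M) ^ n" by (intro mult_left_mono fM) simp
  also have "\<dots> = M ^ n * ((2 * K) ^ n * q ^ card J * card S)"
    using J by (simp add: G_def card_PiE power_mult_distrib)
  finally show ?thesis using M0 by (simp add: G_def)
qed

subsection \<open>Prime powers\<close>

text \<open>Phrased through the prime divisors of \<open>N\<close>, so that no factorisation has to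
  be carried along when moduli are multiplied.\<close>

definition unimod :: "nat \<Rightarrow> nat \<Rightarrow> (nat \<Rightarrow> int) set"
  where "unimod N n = {u \<in> vecs N n. \<forall>p. prime p \<and> p dvd N \<longrightarrow> (\<exists>j<n. \<not> int p dvd u j)}"

definition richest :: "nat \<Rightarrow> nat \<Rightarrow> (nat \<Rightarrow> int) set \<Rightarrow> (nat \<Rightarrow> int) \<Rightarrow> nat"
  where "richest N n S u = Max ((\<lambda>a. card (line N n a u \<inter> S)) ` vecs N n)"

text \<open>Multiplied out and summed over vectors instead of projective points: vectors split under
  the Chinese remainder theorem, and all projective classes have the same size.\<close>

definition kakeya_bound :: "nat \<Rightarrow> nat \<Rightarrow> real \<Rightarrow> bool"
  where "kakeya_bound N n c \<longleftrightarrow> (\<forall>S\<subseteq>vecs N n.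
    c * (\<Sum>u\<in>unimod N n. real (richest N n S u) ^ n) \<le> real (card S) * real (card (unimod N n)))"

lemma vecs_eq: "vecs N n = {..<n} \<rightarrow>\<^sub>E {0..<int N}"
proof -
  have "carrier (Zmod N) = {0..<int N}" by (auto simp: residue_ring_def)
  then show ?thesis by (simp only: vecs_def)
qed

lemma finite_vecs: "finite (vecs N n)"
  unfolding vecs_eq by (intro finite_PiE) auto

lemma finite_unimod: "finite (unimod N n)"
  unfolding unimod_def using finite_vecs by simp

lemma reduce_in_vecs: "N > 0 \<Longrightarrow> (\<lambda>i\<in>{..<n}. f i mod int N) \<in> vecs N n"
  by (simp add: vecs_eq)

lemma vecs_nonempty: "N > 0 \<Longrightarrow> vecs N n \<noteq> {}"
  using reduce_in_vecs by blast

lemma vecs_mod: "a \<in> vecs N n \<Longrightarrow> i < n \<Longrightarrow> a i mod int N = a i"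
  by (auto simp: vecs_eq PiE_iff)

lemma line_eq: "line N n a u = (\<lambda>t. \<lambda>i\<in>{..<n}. (a i + int t * u i) mod int N) ` {..<N}"
proof -
  have "line N n a u = (\<lambda>t. \<lambda>i\<in>{..<n}. (a i + t * u i) mod int N) ` {0..<int N}"
    by (auto simp: line_def residue_ring_def mod_add_right_eq image_iff Bex_def
        simp flip: atLeastLessThanPlusOne_atLeastAtMost_int)
  also have "{0..<int N} = int ` {..<N}" by (simp add: image_int_atLeastLessThan lessThan_atLeast0)
  finally show ?thesis by (simp only: image_image)
qed

lemma line_subset_vecs: "line N n a u \<subseteq> vecs N n"
  unfolding line_eq by (intro image_subsetI reduce_in_vecs) auto

lemma finite_line: "finite (line N n a u)"
  by (simp add: line_eq)

lemma card_line_le_richest: "a \<in> vecs N n \<Longrightarrow> card (line N n a u \<inter> S) \<le> richest N n S u"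
  unfolding richest_def using finite_vecs by (intro Max_ge) auto

lemma richest_attained: "N > 0 \<Longrightarrow> \<exists>a\<in>vecs N n. richest N n S u = card (line N n a u \<inter> S)"
proof -
  assume "N > 0"
  then have "richest N n S u \<in> (\<lambda>a. card (line N n a u \<inter> S)) ` vecs N n"
    unfolding richest_def using finite_vecs vecs_nonempty by (intro Max_in) auto
  then show ?thesis by blast
qed

text \<open>The affine chart of a linear form \<open>m\<close>. Using all unimodular forms instead
  of coordinates makes the family of charts symmetric in \<open>m\<close> and
  \<open>u\<close>.\<close>

definition chart :: "nat \<Rightarrow> nat \<Rightarrow> (nat \<Rightarrow> int) \<Rightarrow> (nat \<Rightarrow> int) set"
  where "chart q n m = {u \<in> unimod q n. [(\<Sum>j<n. m j * u j) = 1] (mod int q)}"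

lemma prime_dvd_prime_power_iff:
  fixes p p' k :: nat
  assumes "prime p" "k \<ge> 1"
  shows "prime p' \<and> p' dvd p ^ k \<longleftrightarrow> p' = p"
proof
  assume "prime p' \<and> p' dvd p ^ k"
  then show "p' = p" using assms(1) prime_dvd_power primes_dvd_imp_eq by blast
next
  assume "p' = p"
  then show "prime p' \<and> p' dvd p ^ k" using assms by (simp add: dvd_power)
qed

lemma unimod_prime_power:
  assumes "prime p" "k \<ge> 1"
  shows "unimod (p ^ k) n = {u \<in> vecs (p ^ k) n. \<exists>j<n. \<not> int p dvd u j}"
  unfolding unimod_def prime_dvd_prime_power_iff [OF assms] by simp

lemma unimod_prime_powerD:
  "prime p \<Longrightarrow> k \<ge> 1 \<Longrightarrow> u \<in> unimod (p ^ k) n \<Longrightarrow> \<exists>j<n. \<not> int p dvd u j"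
  by (simp add: unimod_prime_power)

text \<open>As \<open>m j0\<close> is a unit modulo \<open>q\<close>, the equation determines
  \<open>u j0\<close> from the other coordinates; it also forces unimodularity, since p dividing all
  \<open>u j\<close> would divide 1.\<close>

lemma chart_coordinates:
  fixes p k n :: nat
  assumes p: "prime p" and k: "k \<ge> 1" and j0: "j0 < n" "\<not> int p dvd m j0"
  defines "q \<equiv> p ^ k" and "J \<equiv> {..<n} - {j0}"
  shows "bij_betw (\<lambda>u. \<lambda>j\<in>J. nat (u j)) (chart q n m) (J \<rightarrow>\<^sub>E {..<q})"
proof -
  let ?r = "\<lambda>u. \<lambda>j\<in>J. nat (u j)"
  have q0: "q > 0" using p by (simp add: q_def prime_gt_0_nat)
  have split: "(\<Sum>j<n. m j * u j) = m j0 * u j0 + (\<Sum>j\<in>J. m j * u j)" for u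
    unfolding J_def using j0 by (subst sum.remove [where x = j0]) auto
  have cop: "coprime (m j0) (int q)"
    using p j0(2) by (simp add: q_def prime_imp_coprime coprime_commute)
  have dvd_q: "int p dvd int q" using k by (simp add: q_def dvd_power)
  have inj: "inj_on ?r (chart q n m)"
  proof (rule inj_onI)
    fix u v assume uv: "u \<in> chart q n m" "v \<in> chart q n m" and e: "?r u = ?r v"
    then have V: "u \<in> vecs q n" "v \<in> vecs q n" by (auto simp: chart_def unimod_def)
    have J: "u j = v j" if "j \<in> J" for j
    proof -
      have "nat (u j) = nat (v j)" using fun_cong [OF e, of j] that by simp
      moreover have "0 \<le> u j" "0 \<le> v j" using V that by (auto simp: vecs_eq J_def PiE_iff)
      ultimately show ?thesis by simp
    qed
    have "[(\<Sum>j<n. m j * u j) = (\<Sum>j<n. m j * v j)] (mod int q)"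
      using uv unfolding chart_def by (auto intro: cong_trans cong_sym)
    moreover have "(\<Sum>j\<in>J. m j * u j) = (\<Sum>j\<in>J. m j * v j)" using J by simp
    ultimately have "[m j0 * u j0 = m j0 * v j0] (mod int q)"
      unfolding split by (simp add: cong_add_rcancel)
    then have "[u j0 = v j0] (mod int q)" using cop by (simp add: cong_mult_lcancel)
    then have "u j0 = v j0" using vecs_mod [OF V(1) j0(1)] vecs_mod [OF V(2) j0(1)] by (simp add: cong_def)
    then have "u j = v j" if "j < n" for j using J that by (cases "j = j0") (auto simp: J_def)
    then show "u = v" using V unfolding vecs_eq by (auto intro: PiE_ext)
  qed
  have into: "?r ` chart q n m \<subseteq> J \<rightarrow>\<^sub>E {..<q}"
    by (auto simp: chart_def unimod_def vecs_eq J_def PiE_iff nat_less_iff)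
  have "J \<rightarrow>\<^sub>E {..<q} \<subseteq> ?r ` chart q n m"
  proof
    fix h assume h: "h \<in> J \<rightarrow>\<^sub>E {..<q}"
    obtain c where c: "[m j0 * c = 1] (mod int q)" using cop cong_solve_coprime_int by blast
    define u where "u = (\<lambda>j\<in>{..<n}. if j = j0 then (c * (1 - (\<Sum>j\<in>J. m j * int (h j)))) mod int q else int (h j))"
    have uJ: "u j = int (h j)" if "j \<in> J" for j using that by (auto simp: u_def J_def)
    have V: "u \<in> vecs q n" using h q0 by (auto simp: u_def vecs_eq J_def PiE_iff)
    have "[(\<Sum>j<n. m j * u j) = m j0 * (c * (1 - (\<Sum>j\<in>J. m j * int (h j)))) + (\<Sum>j\<in>J. m j * int (h j))] (mod int q)"
      unfolding split using uJ j0 by (intro cong_add cong_mult) (auto simp: u_def cong_def)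
    also have "m j0 * (c * (1 - (\<Sum>j\<in>J. m j * int (h j)))) + (\<Sum>j\<in>J. m j * int (h j))
        = (m j0 * c) * (1 - (\<Sum>j\<in>J. m j * int (h j))) + (\<Sum>j\<in>J. m j * int (h j))" by simp
    also have "[\<dots> = 1 * (1 - (\<Sum>j\<in>J. m j * int (h j))) + (\<Sum>j\<in>J. m j * int (h j))] (mod int q)"
      by (intro cong_add cong_mult c cong_refl)
    finally have one: "[(\<Sum>j<n. m j * u j) = 1] (mod int q)" by simp
    have "\<exists>j<n. \<not> int p dvd u j"
    proof (rule ccontr)
      assume "\<not> ?thesis"
      then have "int p dvd (\<Sum>j<n. m j * u j)" by (intro dvd_sum) auto
      moreover have "[(\<Sum>j<n. m j * u j) = 1] (mod int p)" using one dvd_q by (rule cong_dvd_modulus)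
      ultimately have "int p dvd 1" using cong_dvd_iff by blast
      then show False using p by simp
    qed
    then have "u \<in> chart q n m" using V one unimod_prime_power [OF p k] by (simp add: chart_def q_def)
    moreover have "?r u = h" using h uJ by (auto simp: fun_eq_iff PiE_iff extensional_def)
    ultimately show "h \<in> ?r ` chart q n m" by blast
  qed
  then show ?thesis using inj into by (auto simp: bij_betw_def)
qed

text \<open>Replace coordinate \<open>j0\<close> by the value of the form \<open>m\<close>. Every
  direction of the chart then has entry 1 at \<open>j0\<close>, and the bound for normalised
  directions applies.\<close>

lemma sum_chart_le:
  fixes p k l n :: nat
  assumes p: "prime p" and k: "k \<ge> 1" and n: "n \<le> p ^ l"
    and S: "S \<subseteq> vecs (p ^ k) n" and m: "m \<in> unimod (p ^ k) n"
  shows "(\<Sum>u\<in>chart (p ^ k) n m. richest (p ^ k) n S u ^ n) \<le> (2 * (k + l)) ^ n * (p ^ k) ^ (n - 1) * card S"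
proof -
  define q where "q = p ^ k"
  obtain j0 where j0: "j0 < n" "\<not> int p dvd m j0" using unimod_prime_powerD [OF p k m] by blast
  define J where "J = {..<n} - {j0}"
  have J: "finite J" "j0 \<notin> J" "n = Suc (card J)" using j0 by (simp_all add: J_def)
  have q0: "q > 0" using p by (simp add: q_def prime_gt_0_nat)
  define r where "r = (\<lambda>u. \<lambda>j\<in>J. nat (u j :: int))"
  have bij: "bij_betw r (chart q n m) (J \<rightarrow>\<^sub>E {..<q})"
    unfolding r_def J_def q_def by (rule chart_coordinates [where m = m, OF p k j0])
  define B where "B x j = (if j = j0 then nat ((\<Sum>i<n. m i * x i) mod int q) else nat (x j))" for x and j
  define dir where "dir h = inv_into (chart q n m) r h" for h
  have dir: "dir h \<in> chart q n m" "r (dir h) = h" if "h \<in> J \<rightarrow>\<^sub>E {..<q}" for h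
    using that bij by (auto simp: dir_def bij_betw_def inv_into_into f_inv_into_f)
  obtain a where a: "\<And>u. a u \<in> vecs q n" "\<And>u. richest q n S u = card (line q n (a u) u \<inter> S)"
    using richest_attained [OF q0, of n S] by metis
  define pt where "pt u t = (\<lambda>i\<in>{..<n}. (a u i + int t * u i) mod int q)" for u t
  define T where "T h = {t. t < q \<and> pt (dir h) t \<in> S}" for h
  have rich: "richest q n S (dir h) \<le> card (T h)" for h
  proof -
    have "line q n (a (dir h)) (dir h) \<inter> S \<subseteq> pt (dir h) ` T h" by (auto simp: line_eq pt_def T_def)
    then have "richest q n S (dir h) \<le> card (pt (dir h) ` T h)"
      unfolding a(2) by (intro card_mono) (simp_all add: T_def)
    also have "\<dots> \<le> card (T h)" by (rule card_image_le) (simp add: T_def)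
    finally show ?thesis .
  qed
  have finS: "finite S" using S finite_vecs finite_subset by blast
  have "(\<Sum>h\<in>J \<rightarrow>\<^sub>E {..<q}. card (T h) ^ n) \<le> (2 * (k + l)) ^ n * q ^ card J * card (B ` S)"
  proof (rule sum_power_chart_le [OF p k q_def J(1,2)])
    show "T h \<subseteq> {..<q}" for h by (auto simp: T_def)
    fix h assume h: "h \<in> J \<rightarrow>\<^sub>E {..<q}"
    let ?u = "dir h"
    have u: "?u \<in> vecs q n" "[(\<Sum>j<n. m j * ?u j) = 1] (mod int q)"
      using dir(1) [OF h] by (auto simp: chart_def unimod_def)
    have uh: "int (h j) = ?u j" if "j \<in> J" for j
    proof -
      have "h j = nat (?u j)" using fun_cong [OF dir(2) [OF h], of j] that by (simp add: r_def)
      moreover have "0 \<le> ?u j" using u(1) that by (auto simp: vecs_eq J_def PiE_iff)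
      ultimately show ?thesis by simp
    qed
    show "\<exists>b. \<forall>t\<in>T h. \<exists>x\<in>B ` S. [b j0 + t = x j0] (mod q) \<and> (\<forall>j\<in>J. [b j + t * h j = x j] (mod q))"
    proof (intro exI [of _ "B (a ?u)"] ballI)
      fix t assume t: "t \<in> T h"
      let ?x = "pt ?u t"
      \<comment> \<open>Since the form is 1 on the direction, its value along the line is its value
        at the base point plus \<open>t\<close>.\<close>
      have lin: "[B (a ?u) j0 + t = B ?x j0] (mod q)"
      proof -
        have "[(\<Sum>i<n. m i * ?x i) = (\<Sum>i<n. m i * (a ?u i + int t * ?u i))] (mod int q)"
          by (intro cong_sum cong_mult cong_refl) (simp add: pt_def cong_def)
        also have "(\<Sum>i<n. m i * (a ?u i + int t * ?u i)) = (\<Sum>i<n. m i * a ?u i) + int t * (\<Sum>i<n. m i * ?u i)"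
          by (simp add: sum_distrib_left sum.distrib algebra_simps)
        also have "[\<dots> = (\<Sum>i<n. m i * a ?u i) mod int q + int t * 1] (mod int q)"
          by (intro cong_add cong_mult u(2) cong_refl) (simp add: cong_def)
        finally have "[(\<Sum>i<n. m i * a ?u i) mod int q + int t = (\<Sum>i<n. m i * ?x i) mod int q] (mod int q)"
          by (simp add: cong_def)
        then have "[int (B (a ?u) j0 + t) = int (B ?x j0)] (mod int q)" using q0 by (simp add: B_def)
        then show ?thesis by (simp only: cong_int_iff)
      qed
      have oth: "[B (a ?u) j + t * h j = B ?x j] (mod q)" if j: "j \<in> J" for j
      proof -
        have jn: "j < n" "j \<noteq> j0" using j by (auto simp: J_def)
        have "0 \<le> a ?u j" using a(1) [of ?u] jn by (auto simp: vecs_eq PiE_iff)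
        then have "[int (B (a ?u) j + t * h j) = int (B ?x j)] (mod int q)"
          using jn q0 uh [OF j] by (simp add: B_def pt_def cong_def)
        then show ?thesis by (simp only: cong_int_iff)
      qed
      show "\<exists>x\<in>B ` S. [B (a ?u) j0 + t = x j0] (mod q) \<and> (\<forall>j\<in>J. [B (a ?u) j + t * h j = x j] (mod q))"
        using t lin oth by (intro bexI [of _ "B ?x"]) (auto simp: T_def)
    qed
  qed (use finS J n in auto)
  also have "\<dots> \<le> (2 * (k + l)) ^ n * q ^ card J * card S"
    by (intro mult_left_mono card_image_le finS) simp
  finally have main: "(\<Sum>h\<in>J \<rightarrow>\<^sub>E {..<q}. card (T h) ^ n) \<le> (2 * (k + l)) ^ n * q ^ (n - 1) * card S"
    using J(3) by simp
  have "(\<Sum>u\<in>chart q n m. richest q n S u ^ n) = (\<Sum>h\<in>J \<rightarrow>\<^sub>E {..<q}. richest q n S (dir h) ^ n)"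
    using sum.reindex_bij_betw [OF bij_betw_inv_into [OF bij], of "\<lambda>u. richest q n S u ^ n"] by (simp add: dir_def)
  also have "\<dots> \<le> (\<Sum>h\<in>J \<rightarrow>\<^sub>E {..<q}. card (T h) ^ n)" by (intro sum_mono power_mono rich) simp
  finally show ?thesis using main unfolding q_def by linarith
qed

text \<open>Both a direction and a linear form are unimodular vectors, and each direction lies in equally
  many charts; hence the bound for the charts averages to the bound for all directions.\<close>

lemma kakeya_bound_prime_power:
  fixes p k l n :: nat
  assumes p: "prime p" and k: "k \<ge> 1" and n: "n \<le> p ^ l"
  shows "kakeya_bound (p ^ k) n ((1 / (2 * real (k + l))) ^ n)"
  unfolding kakeya_bound_def
proof (intro allI impI)
  fix S assume S: "S \<subseteq> vecs (p ^ k) n"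
  define q where "q = p ^ k"
  define U where "U = unimod q n"
  define F where "F u = richest q n S u ^ n" for u
  have q0: "q > 0" using p by (simp add: q_def prime_gt_0_nat)
  have finU: "finite U" by (simp add: U_def finite_unimod)
  have card_chart: "card (chart q n u) = q ^ (n - 1)" if u: "u \<in> U" for u
  proof -
    obtain j0 where j0: "j0 < n" "\<not> int p dvd u j0"
      using unimod_prime_powerD [OF p k] u unfolding U_def q_def by blast
    have "card (chart q n u) = card (({..<n} - {j0}) \<rightarrow>\<^sub>E {..<q})"
      using bij_betw_same_card [OF chart_coordinates [where m = u, OF p k j0]] by (simp add: q_def)
    then show ?thesis using j0(1) by (simp add: card_PiE)
  qed
  \<comment> \<open>The pairing of forms and directions is symmetric, so the number of charts
    through \<open>u\<close> is the size of the chart of \<open>u\<close>.\<close>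
  have sym: "m \<in> U \<and> u \<in> chart q n m \<longleftrightarrow> u \<in> U \<and> m \<in> chart q n u" for u m
    by (auto simp: chart_def U_def mult.commute)
  have "q ^ (n - 1) * (\<Sum>u\<in>U. F u) = (\<Sum>u\<in>U. \<Sum>m\<in>chart q n u. F u)"
    by (simp add: card_chart sum_distrib_left)
  also have "\<dots> = (\<Sum>u\<in>U. \<Sum>m\<in>U. if m \<in> chart q n u then F u else 0)"
    using finU by (intro sum.cong refl sum.mono_neutral_cong_left) (auto simp: chart_def U_def)
  also have "\<dots> = (\<Sum>m\<in>U. \<Sum>u\<in>U. if m \<in> chart q n u then F u else 0)" by (rule sum.swap)
  also have "\<dots> = (\<Sum>m\<in>U. \<Sum>u\<in>chart q n m. F u)"
  proof (rule sum.cong [OF refl])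
    fix m assume "m \<in> U"
    then have "{u \<in> U. m \<in> chart q n u} = chart q n m" using sym by (auto simp: chart_def U_def)
    then show "(\<Sum>u\<in>U. if m \<in> chart q n u then F u else 0) = (\<Sum>u\<in>chart q n m. F u)"
      using finU by (simp flip: sum.inter_filter)
  qed
  also have "\<dots> \<le> (\<Sum>m\<in>U. (2 * (k + l)) ^ n * q ^ (n - 1) * card S)"
    using sum_chart_le [OF p k n S] by (intro sum_mono) (simp add: F_def U_def q_def)
  also have "\<dots> = q ^ (n - 1) * ((2 * (k + l)) ^ n * (card S * card U))" by simp
  finally have "(\<Sum>u\<in>U. F u) \<le> (2 * (k + l)) ^ n * (card S * card U)" using q0 by simp
  then have "real (\<Sum>u\<in>U. F u) \<le> real ((2 * (k + l)) ^ n * (card S * card U))" by (rule of_nat_mono)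
  then have "(\<Sum>u\<in>U. real (richest q n S u) ^ n) \<le> (2 * real (k + l)) ^ n * (real (card S) * real (card U))"
    by (simp add: F_def)
  moreover have "2 * real (k + l) > 0" using k by simp
  ultimately show "(1 / (2 * real (k + l))) ^ n * (\<Sum>u\<in>unimod (p ^ k) n. real (richest (p ^ k) n S u) ^ n)
      \<le> real (card S) * real (card (unimod (p ^ k) n))"
    by (simp add: U_def q_def power_one_over divide_le_eq mult.commute)
qed

subsection \<open>Level sets and the Chinese remainder theorem\<close>

lemma sum_inverse_le_one_plus_ln: "m \<ge> 1 \<Longrightarrow> (\<Sum>i=1..m. 1 / real i) \<le> 1 + ln (real m)"
proof (induction m rule: dec_induct)
  case (step m)
  have m: "real m > 0" using step by simp
  have "ln (real m / real (Suc m)) \<le> real m / real (Suc m) - 1"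
    using m by (intro ln_le_minus_one) simp
  moreover have "real m / real (Suc m) - 1 = - (1 / real (Suc m))" by (simp add: field_simps)
  ultimately have "1 / real (Suc m) \<le> ln (real (Suc m)) - ln (real m)" using m by (simp add: ln_div)
  then show ?case using step by simp
qed simp

text \<open>The i-th largest value is at most \<open>B / i\<close>. The induction removes a minimum
  \<open>x\<close>: at level \<open>g x\<close> all of \<open>L\<close> is counted, so
  \<open>g x * card L \<le> B\<close>.\<close>

lemma sum_le_weak_type:
  fixes g :: "'x \<Rightarrow> nat" and B :: real
  assumes "finite L" and "B \<ge> 0" and "\<And>m. m \<ge> 1 \<Longrightarrow> real (m * card {x\<in>L. m \<le> g x}) \<le> B"
  shows "real (\<Sum>x\<in>L. g x) \<le> B * (\<Sum>i=1..card L. 1 / real i)"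
  using assms
proof (induction "card L" arbitrary: L)
  case (Suc c)
  then have ne: "finite L" "L \<noteq> {}" by auto
  then have "Min (g ` L) \<in> g ` L" by (intro Min_in) auto
  then obtain x where x0: "Min (g ` L) = g x" "x \<in> L" by (rule imageE)
  have x: "x \<in> L" "\<And>y. y \<in> L \<Longrightarrow> g x \<le> g y"
    using x0 ne by (simp_all flip: x0(1))
  have c: "c = card (L - {x})" using Suc.hyps(2) x ne by simp
  have "real (\<Sum>y\<in>L - {x}. g y) \<le> B * (\<Sum>i=1..card (L - {x}). 1 / real i)"
  proof (rule Suc.hyps(1) [OF c])
    fix m :: nat assume m: "m \<ge> 1"
    have "card {y \<in> L - {x}. m \<le> g y} \<le> card {y \<in> L. m \<le> g y}" using ne by (intro card_mono) auto
    then have "real (m * card {y \<in> L - {x}. m \<le> g y}) \<le> real (m * card {y \<in> L. m \<le> g y})"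
      by (intro of_nat_mono mult_left_mono) auto
    then show "real (m * card {y \<in> L - {x}. m \<le> g y}) \<le> B" using Suc.prems(3) [OF m] by linarith
  qed (use Suc.prems in auto)
  moreover have "real (g x) \<le> B * (1 / real (Suc c))"
  proof (cases "g x = 0")
    case False
    have "{y \<in> L. g x \<le> g y} = L" using x by auto
    then have "real (g x * Suc c) \<le> B" using Suc.prems(3) [of "g x"] False Suc.hyps(2) by simp
    then show ?thesis by (simp add: pos_le_divide_eq distrib_left)
  qed (use Suc.prems in simp)
  moreover have "(\<Sum>y\<in>L. g y) = g x + (\<Sum>y\<in>L - {x}. g y)" using ne x by (simp add: sum.remove)
  ultimately show ?case unfolding Suc.hyps(2) [symmetric] c [symmetric] by (simp add: distrib_left)
qed simp

lemma ex_level: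
  fixes g :: "'x \<Rightarrow> nat"
  assumes L: "finite L" "card L \<le> q" and q: "q \<ge> 1"
  shows "\<exists>m\<ge>1. real (\<Sum>x\<in>L. g x) \<le> (1 + ln (real q)) * real (m * card {x\<in>L. m \<le> g x})"
proof -
  let ?f = "\<lambda>m. m * card {x\<in>L. m \<le> g x}"
  \<comment> \<open>Levels above the total sum have empty level sets; \<open>Suc\<close> keeps the
    range nonempty when the sum is 0.\<close>
  let ?X = "{1..Suc (\<Sum>x\<in>L. g x)}"
  have "Max (?f ` ?X) \<in> ?f ` ?X" by (intro Max_in) auto
  then obtain m where m: "Max (?f ` ?X) = ?f m" "m \<in> ?X" by (rule imageE)
  have B: "real (?f m') \<le> real (?f m)" if "m' \<ge> 1" for m'
  proof (cases "m' \<in> ?X")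
    case True
    then show ?thesis unfolding m(1) [symmetric] by (intro of_nat_mono Max_ge) auto
  next
    case False
    have "\<not> m' \<le> g x" if "x \<in> L" for x
      using member_le_sum [of x L g] that L False \<open>m' \<ge> 1\<close> by auto
    then have "{x\<in>L. m' \<le> g x} = {}" by blast
    then show ?thesis by (simp only: card.empty mult_0_right of_nat_0 of_nat_0_le_iff)
  qed
  have "real (\<Sum>x\<in>L. g x) \<le> real (?f m) * (\<Sum>i=1..card L. 1 / real i)"
    by (rule sum_le_weak_type [OF L(1) _ B]) simp_all
  also have "\<dots> \<le> real (?f m) * (1 + ln (real q))"
  proof (rule mult_left_mono)
    have "(\<Sum>i=1..card L. 1 / real i) \<le> (\<Sum>i=1..q. 1 / real i)"
      using L(2) by (intro sum_mono2) auto
    also have "\<dots> \<le> 1 + ln (real q)" by (rule sum_inverse_le_one_plus_ln [OF q])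
    finally show "(\<Sum>i=1..card L. 1 / real i) \<le> 1 + ln (real q)" .
  qed simp
  finally have "real (\<Sum>x\<in>L. g x) \<le> (1 + ln (real q)) * real (?f m)" by (simp only: mult.commute)
  then show ?thesis using m(2) by (intro exI [of _ m] conjI) auto
qed

lemma sum_power_diff_telescope:
  "n \<ge> 1 \<Longrightarrow> (\<Sum>m=1..h. real m ^ n - real (m - 1) ^ n) = real h ^ n"
  by (induction h) simp_all

text \<open>The maximal inequality for sets implies one for functions, by summing over the level sets
  and picking, for each direction, the level that carries most of the mass of the best line.\<close>

lemma kakeya_bound_function:
  fixes h :: "(nat \<Rightarrow> int) \<Rightarrow> nat" and b :: "(nat \<Rightarrow> int) \<Rightarrow> (nat \<Rightarrow> int)"
  assumes bound: "kakeya_bound q n c" and q: "q \<ge> 1" and n: "n \<ge> 1" and c: "c \<ge> 0"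
    and b: "\<And>u. b u \<in> vecs q n"
  shows "c * (\<Sum>u\<in>unimod q n. real (\<Sum>x\<in>line q n (b u) u. h x) ^ n)
    \<le> (1 + ln (real q)) ^ n * (\<Sum>x\<in>vecs q n. real (h x) ^ n) * real (card (unimod q n))"
proof -
  define H where "H = 1 + ln (real q)"
  define E where "E m = {x \<in> vecs q n. m \<le> h x}" for m
  define L where "L u = line q n (b u) u" for u
  have H0: "H \<ge> 0" using q by (simp add: H_def)
  have LV: "L u \<subseteq> vecs q n" for u using line_subset_vecs by (simp add: L_def)
  have "\<exists>m\<ge>1. real (\<Sum>x\<in>L u. h x) \<le> H * real (m * card (L u \<inter> E m))" for u
  proof -
    have "card (L u) \<le> card {..<q}" unfolding L_def line_eq by (rule card_image_le) simp
    then have "card (L u) \<le> q" by simp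
    moreover have "{x \<in> L u. m \<le> h x} = L u \<inter> E m" for m using LV by (auto simp: E_def)
    ultimately show ?thesis using ex_level [of "L u" q h] q finite_line by (simp add: L_def H_def)
  qed
  then obtain m where m: "\<And>u. m u \<ge> 1" "\<And>u. real (\<Sum>x\<in>L u. h x) \<le> H * real (m u * card (L u \<inter> E (m u)))"
    by metis
  \<comment> \<open>A common upper bound for all chosen levels and all values of \<open>h\<close>,
    so that one range of summation serves every direction and every point.\<close>
  define X where "X = (\<Sum>x\<in>vecs q n. h x) + (\<Sum>u\<in>unimod q n. m u)"
  define W where "W i = real i ^ n - real (i - 1) ^ n" for i
  have W0: "W i \<ge> 0" for i unfolding W_def using power_mono [of "real (i - 1)" "real i" n] by simp
  have each: "real (\<Sum>x\<in>L u. h x) ^ n \<le> H ^ n * (\<Sum>i=1..X. W i * real (card (L u \<inter> E i)) ^ n)" if u: "u \<in> unimod q n" for u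
  proof -
    have mX: "m u \<le> X" using member_le_sum [of u "unimod q n" m] u finite_unimod by (simp add: X_def)
    have "real (\<Sum>x\<in>L u. h x) ^ n \<le> (H * real (m u * card (L u \<inter> E (m u)))) ^ n"
      by (intro power_mono m of_nat_0_le_iff)
    also have "\<dots> = H ^ n * ((\<Sum>i=1..m u. W i) * real (card (L u \<inter> E (m u))) ^ n)"
      unfolding W_def sum_power_diff_telescope [OF n] by (simp add: power_mult_distrib mult.assoc)
    \<comment> \<open>Level sets shrink as the level grows, so the chosen level is dominated by each
      lower one. The resulting sum has weights independent of \<open>u\<close>, and the bound for
      sets can be applied level by level.\<close>
    also have "(\<Sum>i=1..m u. W i) * real (card (L u \<inter> E (m u))) ^ n
        \<le> (\<Sum>i=1..m u. W i * real (card (L u \<inter> E i)) ^ n)"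
      unfolding sum_distrib_right
    proof (intro sum_mono mult_left_mono power_mono W0)
      fix i assume i: "i \<in> {1..m u}"
      have "card (L u \<inter> E (m u)) \<le> card (L u \<inter> E i)"
        using i finite_line by (intro card_mono) (auto simp: E_def L_def)
      then show "real (card (L u \<inter> E (m u))) \<le> real (card (L u \<inter> E i))" by simp
    qed simp
    also have "\<dots> \<le> (\<Sum>i=1..X. W i * real (card (L u \<inter> E i)) ^ n)"
      using mX W0 by (intro sum_mono2) auto
    finally show ?thesis using H0 by (simp add: mult_left_mono)
  qed
  have level: "c * (\<Sum>u\<in>unimod q n. real (card (L u \<inter> E i)) ^ n) \<le> real (card (E i)) * real (card (unimod q n))" for i
  proof -
    have "c * (\<Sum>u\<in>unimod q n. real (card (L u \<inter> E i)) ^ n) \<le> c * (\<Sum>u\<in>unimod q n. real (richest q n (E i) u) ^ n)"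
      using c card_line_le_richest [OF b] by (intro mult_left_mono sum_mono power_mono) (auto simp: L_def)
    also have "\<dots> \<le> real (card (E i)) * real (card (unimod q n))"
      using bound unfolding kakeya_bound_def by (auto simp: E_def)
    finally show ?thesis .
  qed
  have layer: "(\<Sum>i=1..X. W i * real (card (E i))) = (\<Sum>x\<in>vecs q n. real (h x) ^ n)"
  proof -
    have "(\<Sum>i=1..X. W i * real (card (E i))) = (\<Sum>i=1..X. \<Sum>x\<in>vecs q n. if i \<le> h x then W i else 0)"
      using finite_vecs by (intro sum.cong refl) (simp add: E_def sum.If_cases Int_def mult.commute)
    also have "\<dots> = (\<Sum>x\<in>vecs q n. \<Sum>i=1..X. if i \<le> h x then W i else 0)" by (rule sum.swap)
    also have "\<dots> = (\<Sum>x\<in>vecs q n. \<Sum>i=1..h x. W i)"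
    proof (rule sum.cong [OF refl])
      fix x assume "x \<in> vecs q n"
      then have "h x \<le> X" using member_le_sum [of x "vecs q n" h] finite_vecs by (simp add: X_def trans_le_add1)
      then show "(\<Sum>i=1..X. if i \<le> h x then W i else 0) = (\<Sum>i=1..h x. W i)"
        by (intro sum.mono_neutral_cong_right) auto
    qed
    finally show ?thesis unfolding W_def sum_power_diff_telescope [OF n] .
  qed
  have "c * (\<Sum>u\<in>unimod q n. real (\<Sum>x\<in>L u. h x) ^ n)
      \<le> c * (\<Sum>u\<in>unimod q n. H ^ n * (\<Sum>i=1..X. W i * real (card (L u \<inter> E i)) ^ n))"
    using c each by (intro mult_left_mono sum_mono) auto
  also have "\<dots> = H ^ n * (\<Sum>u\<in>unimod q n. \<Sum>i=1..X. W i * (c * real (card (L u \<inter> E i)) ^ n))"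
    by (simp add: sum_distrib_left mult_ac)
  also have "\<dots> = H ^ n * (\<Sum>i=1..X. W i * (c * (\<Sum>u\<in>unimod q n. real (card (L u \<inter> E i)) ^ n)))"
    by (subst sum.swap) (simp add: sum_distrib_left)
  also have "\<dots> \<le> H ^ n * (\<Sum>i=1..X. W i * (real (card (E i)) * real (card (unimod q n))))"
    using H0 W0 level by (intro mult_left_mono sum_mono) auto
  also have "\<dots> = H ^ n * (\<Sum>x\<in>vecs q n. real (h x) ^ n) * real (card (unimod q n))"
    unfolding layer [symmetric] by (simp add: sum_distrib_right sum_distrib_left mult_ac)
  finally show ?thesis by (simp add: L_def H_def)
qed

section \<open>Splitting directions and lines over coprime moduli\<close>

definition reduce :: "nat \<Rightarrow> nat \<Rightarrow> (nat \<Rightarrow> int) \<Rightarrow> (nat \<Rightarrow> int)"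
  where "reduce m n w = (\<lambda>i\<in>{..<n}. w i mod int m)"

lemma reduce_pair_eqD:
  assumes cop: "coprime q N" and w: "w \<in> vecs (q * N) n" "w' \<in> vecs (q * N) n"
    and e: "reduce q n w = reduce q n w'" "reduce N n w = reduce N n w'"
  shows "w = w'"
proof -
  have "w i = w' i" if i: "i < n" for i
  proof -
    have "[w i = w' i] (mod int q)" "[w i = w' i] (mod int N)"
      using fun_cong [OF e(1), of i] fun_cong [OF e(2), of i] i by (simp_all add: reduce_def cong_def)
    then have "[w i = w' i] (mod int q * int N)" using cop by (intro coprime_cong_mult) auto
    then show ?thesis using vecs_mod [OF w(1) i] vecs_mod [OF w(2) i] by (simp add: cong_def)
  qed
  then show ?thesis using w unfolding vecs_eq by (auto intro: PiE_ext)
qed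

lemma prime_dvd_mod_iff: "int p dvd x mod int m \<longleftrightarrow> int p dvd x" if "p dvd m"
  using that by (simp add: dvd_mod_iff)

lemma bij_betw_unimod_mult:
  assumes cop: "coprime q N" and pos: "q > 0" "N > 0"
  shows "bij_betw (\<lambda>u. (reduce q n u, reduce N n u)) (unimod (q * N) n) (unimod q n \<times> unimod N n)"
proof (rule bij_betwI')
  fix u v assume "u \<in> unimod (q * N) n" "v \<in> unimod (q * N) n"
  then show "((reduce q n u, reduce N n u) = (reduce q n v, reduce N n v)) \<longleftrightarrow> u = v"
    using reduce_pair_eqD [OF cop] by (auto simp: unimod_def)
next
  fix u assume u: "u \<in> unimod (q * N) n"
  have "reduce m n u \<in> unimod m n" if m: "m dvd q * N" "m > 0" for m
  proof -
    have "\<exists>j<n. \<not> int p dvd reduce m n u j" if p: "prime p" "p dvd m" for p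
    proof -
      obtain j where "j < n" "\<not> int p dvd u j" using u p m by (auto simp: unimod_def intro: dvd_trans)
      then show ?thesis using p by (auto simp: reduce_def prime_dvd_mod_iff)
    qed
    then show ?thesis using m reduce_in_vecs [of m u n] by (auto simp: unimod_def reduce_def)
  qed
  then show "(reduce q n u, reduce N n u) \<in> unimod q n \<times> unimod N n" using pos by simp
next
  fix y assume "y \<in> unimod q n \<times> unimod N n"
  then obtain u v where y: "y = (u, v)" "u \<in> unimod q n" "v \<in> unimod N n" by auto
  have V: "u \<in> vecs q n" "v \<in> vecs N n" using y by (auto simp: unimod_def)
  have "\<exists>x. [x = u i] (mod int q) \<and> [x = v i] (mod int N)" for i
    using cop by (intro binary_chinese_remainder_int) auto
  then obtain x where x: "\<And>i. [x i = u i] (mod int q)" "\<And>i. [x i = v i] (mod int N)" by metis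
  define w where "w = reduce (q * N) n x"
  have wV: "w \<in> vecs (q * N) n" unfolding w_def reduce_def using pos by (intro reduce_in_vecs) simp
  have wu: "reduce q n w = u"
  proof
    fix i show "reduce q n w i = u i"
      using x(1) [of i] vecs_mod [OF V(1), of i] V(1)
      by (cases "i < n") (auto simp: w_def reduce_def cong_def mod_mod_cancel vecs_eq PiE_iff extensional_def)
  qed
  have wv: "reduce N n w = v"
  proof
    fix i show "reduce N n w i = v i"
      using x(2) [of i] vecs_mod [OF V(2), of i] V(2)
      by (cases "i < n") (auto simp: w_def reduce_def cong_def mod_mod_cancel vecs_eq PiE_iff extensional_def)
  qed
  have "\<exists>j<n. \<not> int p dvd w j" if p: "prime p" "p dvd q * N" for p
  proof -
    consider "p dvd q" | "p dvd N" using p prime_dvd_mult_iff by blast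
    then show ?thesis
    proof cases
      case 1
      then obtain j where "j < n" "\<not> int p dvd reduce q n w j" using y(2) p wu by (auto simp: unimod_def)
      then show ?thesis using 1 by (auto simp: reduce_def prime_dvd_mod_iff)
    next
      case 2
      then obtain j where "j < n" "\<not> int p dvd reduce N n w j" using y(3) p wv by (auto simp: unimod_def)
      then show ?thesis using 2 by (auto simp: reduce_def prime_dvd_mod_iff)
    qed
  qed
  then have "w \<in> unimod (q * N) n" using wV by (simp add: unimod_def)
  then show "\<exists>u\<in>unimod (q * N) n. y = (reduce q n u, reduce N n u)" using y(1) wu wv by auto
qed

lemma reduce_line:
  assumes m: "m dvd N" "m > 0" and w: "w \<in> line N n a u"
  shows "reduce m n w \<in> line m n (reduce m n a) (reduce m n u)"
proof -
  obtain t where t: "w = (\<lambda>i\<in>{..<n}. (a i + int t * u i) mod int N)" using w by (auto simp: line_eq)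
  have "reduce m n w = (\<lambda>i\<in>{..<n}. (reduce m n a i + int (t mod m) * reduce m n u i) mod int m)"
  proof
    fix i
    have "[a i mod int m + (int t mod int m) * (u i mod int m) = a i + int t * u i] (mod int m)"
      by (intro cong_add cong_mult) (simp_all add: cong_def)
    then show "reduce m n w i = (\<lambda>i\<in>{..<n}. (reduce m n a i + int (t mod m) * reduce m n u i) mod int m) i"
      using m(1) by (simp add: t reduce_def mod_mod_cancel zmod_int cong_def)
  qed
  moreover have "t mod m \<in> {..<m}" using m by simp
  ultimately show ?thesis unfolding line_eq by blast
qed

text \<open>A point of the line is determined by its two reductions. Over a fixed point
  \<open>x\<close> modulo \<open>q\<close>, the second reduction lies both on a line modulo
  \<open>N\<close> and in the fibre of \<open>S\<close> over \<open>x\<close>.\<close>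

lemma card_line_inter_mult_le:
  assumes cop: "coprime q N" and pos: "q > 0" "N > 0"
    and fib: "\<And>x. fib x = reduce N n ` {w \<in> S. reduce q n w = x}"
  shows "card (line (q * N) n a u \<inter> S)
    \<le> (\<Sum>x\<in>line q n (reduce q n a) (reduce q n u). richest N n (fib x) (reduce N n u))"
proof -
  let ?L = "line q n (reduce q n a) (reduce q n u)" and ?L' = "line N n (reduce N n a) (reduce N n u)"
  let ?f = "\<lambda>w. (reduce q n w, reduce N n w)"
  have "card (line (q * N) n a u \<inter> S) \<le> card (SIGMA x:?L. ?L' \<inter> fib x)"
  proof (rule card_inj_on_le)
    show "inj_on ?f (line (q * N) n a u \<inter> S)"
      using reduce_pair_eqD [OF cop] line_subset_vecs by (intro inj_onI) blast
    show "?f ` (line (q * N) n a u \<inter> S) \<subseteq> (SIGMA x:?L. ?L' \<inter> fib x)"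
      using pos by (auto simp: fib intro: reduce_line [of _ "q * N"])
    show "finite (SIGMA x:?L. ?L' \<inter> fib x)" by (simp add: finite_line)
  qed
  also have "\<dots> = (\<Sum>x\<in>?L. card (?L' \<inter> fib x))" by (simp add: finite_line)
  also have "\<dots> \<le> (\<Sum>x\<in>?L. richest N n (fib x) (reduce N n u))"
    unfolding reduce_def using pos by (intro sum_mono card_line_le_richest reduce_in_vecs)
  finally show ?thesis .
qed

text \<open>For fixed \<open>v\<close> modulo \<open>N\<close>, the inequality for functions handles
  the sum over directions modulo \<open>q\<close>; the inequality for sets, applied in each fibre,
  handles the sum over \<open>v\<close>. Only \<open>q\<close> pays the logarithm.\<close>

lemma kakeya_bound_mult:
  assumes cop: "coprime q N" and pos: "q > 0" "N > 0" and n: "n \<ge> 1"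
    and c: "c \<ge> 0" "c' \<ge> 0" and bound: "kakeya_bound q n c" "kakeya_bound N n c'"
  shows "kakeya_bound (q * N) n (c * c' / (1 + ln (real q)) ^ n)"
  unfolding kakeya_bound_def
proof (intro allI impI)
  fix S assume S: "S \<subseteq> vecs (q * N) n"
  define H where "H = 1 + ln (real q)"
  define U V where "U = unimod q n" and "V = unimod N n"
  define fib where "fib x = reduce N n ` {w \<in> S. reduce q n w = x}" for x
  define h where "h v x = richest N n (fib x) v" for v x
  define G where "G u v = Max ((\<lambda>b. \<Sum>x\<in>line q n b u. h v x) ` vecs q n)" for u v
  have H0: "H > 0" using pos by (simp add: H_def add_pos_nonneg)
  have finS: "finite S" using S finite_vecs finite_subset by blast
  have fin: "finite U" "finite V" by (simp_all add: U_def V_def finite_unimod)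
  have "\<exists>b\<in>vecs q n. G u v = (\<Sum>x\<in>line q n b u. h v x)" for u v
  proof -
    have "G u v \<in> (\<lambda>b. \<Sum>x\<in>line q n b u. h v x) ` vecs q n"
      unfolding G_def using finite_vecs vecs_nonempty [OF pos(1)] by (intro Max_in) auto
    then show ?thesis by blast
  qed
  then obtain b where b: "\<And>u v. b u v \<in> vecs q n" "\<And>u v. G u v = (\<Sum>x\<in>line q n (b u v) u. h v x)" by metis
  have richest: "richest (q * N) n S u \<le> G (reduce q n u) (reduce N n u)" for u
  proof -
    obtain a where a: "richest (q * N) n S u = card (line (q * N) n a u \<inter> S)"
      using richest_attained [of "q * N" n S u] pos by auto
    also have "\<dots> \<le> (\<Sum>x\<in>line q n (reduce q n a) (reduce q n u). h (reduce N n u) x)"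
      unfolding h_def by (rule card_line_inter_mult_le [OF cop pos fib_def])
    also have "\<dots> \<le> G (reduce q n u) (reduce N n u)"
      unfolding G_def reduce_def [of q n a]
      by (rule Max_ge [OF finite_imageI [OF finite_vecs] imageI [OF reduce_in_vecs [OF pos(1)]]])
    finally show ?thesis .
  qed
  have bij: "bij_betw (\<lambda>u. (reduce q n u, reduce N n u)) (unimod (q * N) n) (U \<times> V)"
    unfolding U_def V_def by (rule bij_betw_unimod_mult [OF cop pos])
  have cardUV: "card (unimod (q * N) n) = card U * card V"
    using bij_betw_same_card [OF bij] by (simp add: card_cartesian_product)
  have cardS: "(\<Sum>x\<in>vecs q n. card (fib x)) = card S"
  proof -
    have "(\<Sum>x\<in>vecs q n. card (fib x)) = (\<Sum>x\<in>vecs q n. card {w \<in> S. reduce q n w = x})"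
    proof (rule sum.cong [OF refl])
      fix x
      have "inj_on (reduce N n) {w \<in> S. reduce q n w = x}"
      proof (rule inj_onI)
        fix w w' assume w: "w \<in> {w \<in> S. reduce q n w = x}" "w' \<in> {w \<in> S. reduce q n w = x}"
          and e: "reduce N n w = reduce N n w'"
        have "w \<in> vecs (q * N) n" using w S by blast
        moreover have "w' \<in> vecs (q * N) n" using w S by blast
        moreover have "reduce q n w = reduce q n w'" using w by simp
        ultimately show "w = w'" using e by (rule reduce_pair_eqD [OF cop])
      qed
      then show "card (fib x) = card {w \<in> S. reduce q n w = x}" unfolding fib_def by (rule card_image)
    qed
    also have "\<dots> = card (\<Union>x\<in>vecs q n. {w \<in> S. reduce q n w = x})"
      using finS finite_vecs by (subst card_UN_disjoint) auto
    also have "(\<Union>x\<in>vecs q n. {w \<in> S. reduce q n w = x}) = S"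
      using reduce_in_vecs [OF pos(1)] by (auto simp: reduce_def)
    finally show ?thesis .
  qed
  have fibre: "c' * (\<Sum>v\<in>V. real (h v x) ^ n) \<le> real (card (fib x)) * real (card V)" for x
  proof -
    have "fib x \<subseteq> vecs N n" unfolding fib_def reduce_def using reduce_in_vecs [OF pos(2)] by blast
    then show ?thesis using bound(2) unfolding kakeya_bound_def h_def V_def by blast
  qed
  have base: "c * (\<Sum>u\<in>U. real (G u v) ^ n) \<le> H ^ n * (\<Sum>x\<in>vecs q n. real (h v x) ^ n) * real (card U)" for v
    unfolding b(2) U_def H_def using pos(1) by (intro kakeya_bound_function bound n c b) auto
  have "(\<Sum>u\<in>unimod (q * N) n. real (richest (q * N) n S u) ^ n)
      \<le> (\<Sum>u\<in>unimod (q * N) n. real (G (reduce q n u) (reduce N n u)) ^ n)"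
    using richest by (intro sum_mono power_mono) auto
  also have "\<dots> = (\<Sum>(u, v)\<in>U \<times> V. real (G u v) ^ n)"
    using sum.reindex_bij_betw [OF bij, of "\<lambda>(u, v). real (G u v) ^ n"] by simp
  also have "\<dots> = (\<Sum>v\<in>V. \<Sum>u\<in>U. real (G u v) ^ n)"
    by (subst sum.swap) (simp add: sum.cartesian_product)
  finally have "c * c' * (\<Sum>u\<in>unimod (q * N) n. real (richest (q * N) n S u) ^ n)
      \<le> c * c' * (\<Sum>v\<in>V. \<Sum>u\<in>U. real (G u v) ^ n)"
    using c by (intro mult_left_mono) auto
  also have "\<dots> = c' * (\<Sum>v\<in>V. c * (\<Sum>u\<in>U. real (G u v) ^ n))"
    by (simp add: sum_distrib_left mult_ac)
  also have "\<dots> \<le> c' * (\<Sum>v\<in>V. H ^ n * (\<Sum>x\<in>vecs q n. real (h v x) ^ n) * real (card U))"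
    using c by (intro mult_left_mono sum_mono base) auto
  also have "\<dots> = H ^ n * real (card U) * (\<Sum>v\<in>V. \<Sum>x\<in>vecs q n. c' * real (h v x) ^ n)"
    by (simp add: sum_distrib_left sum_distrib_right mult_ac)
  also have "\<dots> = H ^ n * real (card U) * (\<Sum>x\<in>vecs q n. c' * (\<Sum>v\<in>V. real (h v x) ^ n))"
    by (subst sum.swap) (simp add: sum_distrib_left)
  also have "\<dots> \<le> H ^ n * real (card U) * (\<Sum>x\<in>vecs q n. real (card (fib x)) * real (card V))"
    using H0 by (intro mult_left_mono sum_mono fibre) auto
  also have "\<dots> = H ^ n * (real (card S) * real (card (unimod (q * N) n)))"
    unfolding cardUV cardS [symmetric] by (simp add: sum_distrib_right sum_distrib_left mult_ac)
  finally show "c * c' / (1 + ln (real q)) ^ n * (\<Sum>u\<in>unimod (q * N) n. real (richest (q * N) n S u) ^ n)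
      \<le> real (card S) * real (card (unimod (q * N) n))"
    using H0 by (simp add: H_def [symmetric] divide_le_eq mult_ac)
qed

lemma kakeya_bound_prime_power_log:
  fixes p k n :: nat
  assumes p: "prime p" and k: "k \<ge> 1" and n: "n \<ge> 1"
  shows "kakeya_bound (p ^ k) n ((1 / (2 * (real k + of_int \<lceil>log (real p) (real n)\<rceil>))) ^ n)"
proof -
  \<comment> \<open>As \<open>n \<ge> 1\<close>, the logarithm is nonnegative and \<open>nat\<close>
    loses nothing; \<open>l\<close> is the least exponent with \<open>n \<le> p ^ l\<close>.\<close>
  define l where "l = nat \<lceil>log (real p) (real n)\<rceil>"
  have p1: "real p > 1" using prime_gt_1_nat [OF p] by simp
  have "log (real p) (real n) \<ge> 0" using p1 n by simp
  then have l: "of_int \<lceil>log (real p) (real n)\<rceil> = real l" by (simp add: l_def ceiling_mono)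
  have "log (real p) (real n) \<le> real l" using l by (metis le_of_int_ceiling)
  then have "real n \<le> real p powr real l" using p1 n by (simp add: log_le_iff)
  then have "real n \<le> real (p ^ l)" using p1 by (simp add: powr_realpow)
  then have "n \<le> p ^ l" by (simp only: of_nat_le_iff)
  then show ?thesis using kakeya_bound_prime_power [OF p k, of n l] l by simp
qed

text \<open>The index \<open>s\<close> is the prime power that starts the induction. It is never
  split off as the factor \<open>q\<close>, so it gets no logarithmic term.\<close>

lemma kakeya_bound_prod:
  fixes p k :: "'i \<Rightarrow> nat"
  assumes n: "n \<ge> 1" and "finite I" and "s \<notin> I"
    and "\<And>i. i \<in> insert s I \<Longrightarrow> prime (p i)" and "inj_on p (insert s I)"
    and "\<And>i. i \<in> insert s I \<Longrightarrow> k i \<ge> 1"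
  shows "kakeya_bound (\<Prod>i\<in>insert s I. p i ^ k i) n
    (((\<Prod>i\<in>I. 1 / (real (k i) * ln (real (p i)) + 1)) *
      (\<Prod>i\<in>insert s I. 1 / (2 * (real (k i) + of_int \<lceil>log (real (p i)) (real n)\<rceil>)))) ^ n)"
  using assms(2-)
proof (induction I rule: finite_induct)
  case empty
  then show ?case using kakeya_bound_prime_power_log [of "p s" "k s" n] n by simp
next
  case (insert j I)
  define w where "w i = 1 / (2 * (real (k i) + of_int \<lceil>log (real (p i)) (real n)\<rceil>))" for i
  define N where "N = (\<Prod>i\<in>insert s I. p i ^ k i)"
  define c where "c = ((\<Prod>i\<in>I. 1 / (real (k i) * ln (real (p i)) + 1)) * (\<Prod>i\<in>insert s I. w i)) ^ n"
  have js: "j \<noteq> s" using insert.prems by auto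
  have p0: "p i \<ge> 1" if "i \<in> insert s (insert j I)" for i by (rule prime_ge_1_nat [OF insert.prems(2) [OF that]])
  have w0: "w i \<ge> 0" if "i \<in> insert s (insert j I)" for i
  proof -
    have "log (real (p i)) (real n) \<ge> 0"
      using prime_gt_1_nat [OF insert.prems(2) [OF that]] n by simp
    then have "\<lceil>log (real (p i)) (real n)\<rceil> \<ge> 0" by linarith
    then show ?thesis by (simp add: w_def)
  qed
  have "kakeya_bound N n c"
    unfolding N_def c_def w_def
    by (rule insert.IH) (use insert.prems insert.hyps in \<open>auto simp: inj_on_def\<close>)
  moreover have "kakeya_bound (p j ^ k j) n (w j ^ n)"
    unfolding w_def by (rule kakeya_bound_prime_power_log) (use insert.prems n in auto)
  moreover have "coprime (p j ^ k j) N"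
    unfolding N_def
  proof (rule prod_coprime_right)
    fix i assume i: "i \<in> insert s I"
    then have "p i \<noteq> p j" using insert.prems(3) insert.hyps(2) js by (auto simp: inj_on_def)
    then have "coprime (p j) (p i)" using insert.prems(2) i by (intro primes_coprime) auto
    then show "coprime (p j ^ k j) (p i ^ k i)" by simp
  qed
  moreover have "p j ^ k j > 0" "N > 0"
    using p0 by (force simp: N_def intro: prod_pos)+
  moreover have "c \<ge> 0"
    unfolding c_def using w0 p0 by (intro zero_le_power mult_nonneg_nonneg prod_nonneg ballI) auto
  moreover have "w j ^ n \<ge> 0" using w0 by simp
  ultimately have "kakeya_bound (p j ^ k j * N) n (w j ^ n * c / (1 + ln (real (p j ^ k j))) ^ n)"
    using n by (intro kakeya_bound_mult)
  moreover have "p j ^ k j * N = (\<Prod>i\<in>insert s (insert j I). p i ^ k i)"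
    using insert.hyps insert.prems(1) js by (simp add: N_def insert_commute [of s j])
  moreover have "w j ^ n * c / (1 + ln (real (p j ^ k j))) ^ n =
      ((\<Prod>i\<in>insert j I. 1 / (real (k i) * ln (real (p i)) + 1)) * (\<Prod>i\<in>insert s (insert j I). w i)) ^ n"
  proof -
    have "ln (real (p j ^ k j)) = real (k j) * ln (real (p j))"
      using p0 [of j] by (simp add: ln_realpow)
    then show ?thesis using insert.hyps insert.prems(1) js
      by (simp add: c_def insert_commute [of s j] power_mult_distrib power_divide add.commute mult_ac)
  qed
  ultimately show ?case by (simp only: w_def)
qed

subsection \<open>Projective space\<close>

lemma Units_Zmod: "N > 1 \<Longrightarrow> Units (Zmod N) = {c. 0 < c \<and> c < int N \<and> coprime c (int N)}"
  using residues.res_units_eq [of "int N"] by (simp add: residues_def)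

lemma mod_in_Units: "N > 1 \<Longrightarrow> coprime c (int N) \<Longrightarrow> c mod int N \<in> Units (Zmod N)"
  using residues.mod_in_res_units [of "int N" c] by (simp add: residues_def)

lemma scale_eq: "scale N n c u = (\<lambda>i\<in>{..<n}. (c * u i) mod int N)"
  by (simp add: scale_def residue_ring_def)

lemma mod_prime_power_in_Units_iff:
  assumes p: "prime p" and k: "k \<ge> 1"
  shows "x mod int (p ^ k) \<in> Units (Zmod (p ^ k)) \<longleftrightarrow> \<not> int p dvd x"
proof -
  have q: "p ^ k > 1" using prime_gt_1_nat [OF p] k by (intro one_less_power) auto
  have pi: "prime (int p)" using p by simp
  have "x mod int (p ^ k) \<in> Units (Zmod (p ^ k)) \<longleftrightarrow> coprime x (int (p ^ k))"
  proof
    assume "x mod int (p ^ k) \<in> Units (Zmod (p ^ k))"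
    then have "coprime (x mod int (p ^ k)) (int (p ^ k))" by (simp only: Units_Zmod [OF q] mem_Collect_eq)
    then show "coprime x (int (p ^ k))" using prime_gt_0_nat [OF p] by (subst (asm) coprime_mod_left_iff) auto
  qed (rule mod_in_Units [OF q])
  also have "\<dots> \<longleftrightarrow> coprime x (int p)" using k by simp
  also have "\<dots> \<longleftrightarrow> \<not> int p dvd x"
  proof
    assume "coprime x (int p)"
    then show "\<not> int p dvd x" using coprime_common_divisor [of x "int p" "int p"] pi by (auto dest: not_prime_unit)
  next
    assume "\<not> int p dvd x"
    then have "coprime (int p) x" by (rule prime_imp_coprime [OF pi])
    then show "coprime x (int p)" by (rule coprime_commute [THEN iffD1])
  qed
  finally show ?thesis .
qed

lemma direction_vecs_eq:
  assumes p: "\<And>i. i \<in> {1..r} \<Longrightarrow> prime (p i)" and k: "\<And>i. i \<in> {1..r} \<Longrightarrow> k i \<ge> 1"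
  shows "direction_vecs r p k n = unimod (modulus r p k) n"
proof -
  have primes: "prime q \<and> q dvd modulus r p k \<longleftrightarrow> q \<in> p ` {1..r}" for q
  proof
    assume q: "prime q \<and> q dvd modulus r p k"
    then obtain i where "i \<in> {1..r}" "q dvd p i ^ k i"
      unfolding modulus_def by (auto simp: prime_dvd_prod_iff)
    then show "q \<in> p ` {1..r}" using q p k prime_dvd_prime_power_iff by blast
  next
    assume "q \<in> p ` {1..r}"
    then obtain i where i: "i \<in> {1..r}" "q = p i" by auto
    have "p i ^ k i dvd modulus r p k" unfolding modulus_def using i by (intro dvd_prodI) auto
    moreover have "p i dvd p i ^ k i" using k [OF i(1)] by (simp add: dvd_power)
    ultimately show "prime q \<and> q dvd modulus r p k" using i p dvd_trans by blast
  qed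
  have units: "u mod int (p i ^ k i) \<in> Units (Zmod (p i ^ k i)) \<longleftrightarrow> \<not> int (p i) dvd u" if "i \<in> {1..r}" for i u
    using mod_prime_power_in_Units_iff [OF p [OF that] k [OF that]] .
  have "direction_vecs r p k n = {u \<in> vecs (modulus r p k) n. \<forall>i\<in>{1..r}. \<exists>j<n. \<not> int (p i) dvd u j}"
    unfolding direction_vecs_def using units by blast
  also have "\<dots> = unimod (modulus r p k) n" unfolding unimod_def primes by blast
  finally show ?thesis .
qed

lemma scale_scale: "scale N n c (scale N n d u) = scale N n (c * d mod int N) u"
  by (rule ext) (simp add: scale_eq mod_mult_right_eq mod_mult_left_eq mult.assoc)

lemma scale_by_one: "u \<in> vecs N n \<Longrightarrow> N > 0 \<Longrightarrow> scale N n (1) u = u"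
  by (rule ext) (auto simp: scale_eq vecs_eq PiE_iff extensional_def)

lemma line_scale_subset: "N > 0 \<Longrightarrow> line N n a (scale N n c u) \<subseteq> line N n a u"
proof
  fix w assume N: "N > 0" and "w \<in> line N n a (scale N n c u)"
  then obtain t where t: "w = (\<lambda>i\<in>{..<n}. (a i + int t * scale N n c u i) mod int N)" by (auto simp: line_eq)
  define s where "s = nat (int t * c mod int N)"
  have s: "int s = int t * c mod int N" "s < N" using N by (simp_all add: s_def nat_less_iff)
  have "w = (\<lambda>i\<in>{..<n}. (a i + int s * u i) mod int N)"
  proof
    fix i
    have "[a i + int t * (c * u i mod int N) = a i + int t * (c * u i)] (mod int N)"
      by (intro cong_add cong_mult cong_refl) (simp add: cong_def)
    also have "a i + int t * (c * u i) = a i + (int t * c) * u i" by simp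
    also have "[\<dots> = a i + int s * u i] (mod int N)"
      unfolding s(1) by (intro cong_add cong_mult cong_refl) (simp add: cong_def)
    finally show "w i = (\<lambda>i\<in>{..<n}. (a i + int s * u i) mod int N) i"
      by (simp add: t scale_eq cong_def)
  qed
  then show "w \<in> line N n a u" unfolding line_eq using s(2) by blast
qed

definition unit_orbit :: "nat \<Rightarrow> nat \<Rightarrow> (nat \<Rightarrow> int) \<Rightarrow> (nat \<Rightarrow> int) set"
  where "unit_orbit N n u = (\<lambda>c. scale N n c u) ` Units (Zmod N)"

lemma unit_inverse:
  assumes N: "N > 1" and c: "c \<in> Units (Zmod N)"
  shows "\<exists>d\<in>Units (Zmod N). d * c mod int N = 1"
proof -
  have "coprime c (int N)" using c by (simp add: Units_Zmod [OF N])
  then obtain d where d: "[c * d = 1] (mod int N)" using cong_solve_coprime_int by blast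
  have "coprime d (int N)"
    using d by (metis cong_imp_coprime cong_sym coprime_1_left coprime_mult_left_iff)
  then have "d mod int N \<in> Units (Zmod N)" by (rule mod_in_Units [OF N])
  moreover have "(d mod int N) * c mod int N = 1"
    using d N by (simp add: cong_def mod_mult_left_eq mod_mult_right_eq mult.commute)
  ultimately show ?thesis by blast
qed

lemma unit_mult:
  assumes N: "N > 1" and c: "c \<in> Units (Zmod N)" "d \<in> Units (Zmod N)"
  shows "c * d mod int N \<in> Units (Zmod N)"
  using c by (intro mod_in_Units [OF N]) (simp add: Units_Zmod [OF N])

lemma scale_in_unimod:
  assumes N: "N > 1" and c: "c \<in> Units (Zmod N)" and u: "u \<in> unimod N n"
  shows "scale N n c u \<in> unimod N n"
proof -
  have "\<exists>j<n. \<not> int p dvd scale N n c u j" if p: "prime p" "p dvd N" for p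
  proof -
    obtain j where j: "j < n" "\<not> int p dvd u j" using u p by (auto simp: unimod_def)
    have "coprime c (int N)" using c by (simp add: Units_Zmod [OF N])
    then have "\<not> int p dvd c" using p by (metis coprime_common_divisor int_dvd_int_iff not_prime_unit prime_int_nat_transfer prime_nat_int_transfer)
    then have "\<not> int p dvd c * u j" using p j by (simp add: prime_dvd_mult_iff)
    then show ?thesis using p j by (auto simp: scale_eq prime_dvd_mod_iff)
  qed
  then show ?thesis using N by (simp add: unimod_def scale_eq reduce_in_vecs)
qed

text \<open>Units act freely on unimodular vectors: if \<open>c * u = d * u\<close>, then
  \<open>N\<close> divided by the gcd of \<open>c - d\<close> and \<open>N\<close> divides every
  coordinate of \<open>u\<close>, so it has no prime factor. Hence all projective points contain
  equally many vectors.\<close>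

lemma card_unit_orbit:
  assumes N: "N > 1" and u: "u \<in> unimod N n"
  shows "card (unit_orbit N n u) = card (Units (Zmod N))"
  unfolding unit_orbit_def
proof (rule card_image, rule inj_onI)
  fix c d assume cd: "c \<in> Units (Zmod N)" "d \<in> Units (Zmod N)" and e: "scale N n c u = scale N n d u"
  define g where "g = gcd (c - d) (int N)"
  define m where "m = nat (int N div g)"
  have g: "g > 0" using N by (simp add: g_def)
  have gN: "int N = g * (int N div g)" by (simp add: g_def)
  have m: "int N = g * int m"
    using gN g by (simp add: m_def pos_imp_zdiv_nonneg_iff)
  have cop: "coprime ((c - d) div g) (int m)"
    using g m N unfolding g_def by (metis div_gcd_coprime gcd_eq_0_iff less_irrefl nonzero_mult_div_cancel_left)
  have mu: "int m dvd u j" if j: "j < n" for j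
  proof -
    have "[c * u j = d * u j] (mod int N)"
      using fun_cong [OF e, of j] j by (simp add: scale_eq cong_def)
    then have "int N dvd (c - d) * u j" by (simp add: cong_iff_dvd_diff left_diff_distrib)
    moreover have "c - d = g * ((c - d) div g)" by (simp add: g_def)
    ultimately have "g * int m dvd g * ((c - d) div g * u j)" using m by (metis mult.assoc)
    then have "int m dvd (c - d) div g * u j" using g by simp
    then show ?thesis using cop by (simp add: coprime_dvd_mult_right_iff coprime_commute)
  qed
  have "m = 1"
  proof (rule ccontr)
    assume "m \<noteq> 1"
    then obtain p where p: "prime p" "p dvd m" using prime_factor_nat by blast
    have "m dvd N" using m by (metis dvd_triv_right int_dvd_int_iff)
    then obtain j where "j < n" "\<not> int p dvd u j" using u p by (auto simp: unimod_def intro: dvd_trans)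
    then show False using mu [of j] p by (meson dvd_trans int_dvd_int_iff)
  qed
  then have "int N = g" using m by simp
  moreover have "g dvd c - d" by (simp add: g_def)
  ultimately have "int N dvd c - d" by simp
  then have "[c = d] (mod int N)" by (simp add: cong_iff_dvd_diff)
  then show "c = d" using cd by (simp add: Units_Zmod [OF N] cong_def)
qed

lemma equiv_proj_rel:
  assumes D: "direction_vecs r p k n = unimod N n" and m: "N = modulus r p k" and N: "N > 1"
  shows "equiv (unimod N n) (proj_rel r p k n)" and "u \<in> unimod N n \<Longrightarrow> proj_rel r p k n `` {u} = unit_orbit N n u"
proof -
  have rel: "(u, v) \<in> proj_rel r p k n \<longleftrightarrow> u \<in> unimod N n \<and> v \<in> unit_orbit N n u" for u v
    using scale_in_unimod [OF N] unfolding proj_rel_def D m [symmetric] unit_orbit_def by auto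
  then show "u \<in> unimod N n \<Longrightarrow> proj_rel r p k n `` {u} = unit_orbit N n u" by auto
  have one: "1 \<in> Units (Zmod N)" using N by (simp add: Units_Zmod)
  have orbit: "v \<in> unimod N n" if "u \<in> unimod N n" "v \<in> unit_orbit N n u" for u v
    using that scale_in_unimod [OF N] by (auto simp: unit_orbit_def)
  show "equiv (unimod N n) (proj_rel r p k n)"
  proof (rule equivI)
    show "proj_rel r p k n \<subseteq> unimod N n \<times> unimod N n" using rel orbit by auto
    show "refl_on (unimod N n) (proj_rel r p k n)"
    proof (rule refl_onI)
      fix u assume u: "u \<in> unimod N n"
      then have "u = scale N n (1) u" using N by (simp add: scale_by_one unimod_def)
      then have "u \<in> unit_orbit N n u" using one unfolding unit_orbit_def by blast
      then show "(u, u) \<in> proj_rel r p k n" using u by (simp add: rel)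
    qed
    show "sym (proj_rel r p k n)"
    proof (rule symI)
      fix u v assume "(u, v) \<in> proj_rel r p k n"
      then obtain c where u: "u \<in> unimod N n" and c: "c \<in> Units (Zmod N)" "v = scale N n c u"
        by (auto simp: rel unit_orbit_def)
      obtain d where d: "d \<in> Units (Zmod N)" "d * c mod int N = 1" using unit_inverse [OF N c(1)] by blast
      have "u = scale N n d v" using c(2) d(2) u N by (simp add: scale_scale scale_by_one unimod_def)
      then have "u \<in> unit_orbit N n v" using d(1) unfolding unit_orbit_def by blast
      then show "(v, u) \<in> proj_rel r p k n" using scale_in_unimod [OF N c(1) u] c(2) by (simp add: rel)
    qed
    show "trans (proj_rel r p k n)"
    proof (rule transI)
      fix u v w assume "(u, v) \<in> proj_rel r p k n" "(v, w) \<in> proj_rel r p k n"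
      then obtain c d where u: "u \<in> unimod N n" and c: "c \<in> Units (Zmod N)" "v = scale N n c u"
        and d: "d \<in> Units (Zmod N)" "w = scale N n d v" by (auto simp: rel unit_orbit_def)
      have "w = scale N n (d * c mod int N) u" using c d by (simp add: scale_scale)
      then have "w \<in> unit_orbit N n u" using unit_mult [OF N d(1) c(1)] unfolding unit_orbit_def by blast
      then show "(u, w) \<in> proj_rel r p k n" using u by (simp add: rel)
    qed
  qed
qed

theorem theorem1p2:
  fixes n r N :: nat and p k :: "nat \<Rightarrow> nat"
    and S :: "(nat \<Rightarrow> int) set" and rep :: "(nat \<Rightarrow> int) set \<Rightarrow> (nat \<Rightarrow> int)"
  assumes "n \<ge> 1" and "r \<ge> 1"
    and "\<And>i. i \<in> {1..r} \<Longrightarrow> prime (p i)"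
    and "inj_on p {1..r}"
    and "\<And>i. i \<in> {1..r} \<Longrightarrow> k i \<ge> 1"
    and "N = modulus r p k"
    and "\<And>L. L \<in> proj_space r p k n \<Longrightarrow> rep L \<in> L"
    and "S \<subseteq> vecs N n"
  shows "real (card S) \<ge>
    kakeya_const r p k n / real (card (proj_space r p k n)) *
      (\<Sum>L\<in>proj_space r p k n. SUP a\<in>vecs N n. real (card (line N n a (rep L) \<inter> S)) ^ n)"
proof -
  define U P R where "U = unimod N n" and "P = proj_space r p k n" and "R = proj_rel r p k n"
  define \<phi> where "\<phi> = card (Units (Zmod N))"
  define F where "F u = real (richest N n S u) ^ n" for u
  define C where "C = kakeya_const r p k n"
  have r: "{1..r} = insert r {1..<r}" using assms(2) by auto
  have p1: "p i > 1" if "i \<in> {1..r}" for i using prime_gt_1_nat [OF assms(3) [OF that]] .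
  have N: "N > 1"
  proof -
    have "p r ^ k r dvd N" unfolding assms(6) modulus_def using assms(2) by (intro dvd_prodI) auto
    moreover have "p r ^ k r > 1" using p1 [of r] assms(2) assms(5) [of r] by (intro one_less_power) auto
    moreover have "N > 0" unfolding assms(6) modulus_def using p1 by (intro prod_pos) (force intro: zero_less_power)
    ultimately show ?thesis using dvd_imp_le less_le_trans by blast
  qed
  have D: "direction_vecs r p k n = unimod N n" unfolding assms(6) by (rule direction_vecs_eq [OF assms(3,5)])
  have eqv: "equiv U R" unfolding U_def R_def by (rule equiv_proj_rel(1) [OF D assms(6) N])
  have P_eq: "P = U // R" by (simp add: P_def U_def R_def proj_space_def D)
  have finU: "finite U" by (simp add: U_def finite_unimod)
  have finP: "finite P" unfolding P_eq using finU eqv by (meson equiv_type finite_quotient)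
  have UP: "\<Union>P = U" unfolding P_eq by (rule Union_quotient [OF eqv])
  have disj: "\<forall>A\<in>P. \<forall>B\<in>P. A \<noteq> B \<longrightarrow> A \<inter> B = {}" unfolding P_eq using quotient_disj [OF eqv] by blast
  have finL: "\<forall>L\<in>P. finite L" using finU UP by (meson Union_upper finite_subset)
  have L_rep: "L = unit_orbit N n (rep L)" if L: "L \<in> P" for L
  proof -
    have rL: "rep L \<in> L" using assms(7) L by (simp add: P_def)
    then have "rep L \<in> U" using L UP by blast
    moreover obtain u where "L = R `` {u}" using L unfolding P_eq by (rule quotientE)
    ultimately have "L = R `` {rep L}" using rL equiv_class_eq [OF eqv] by blast
    then show ?thesis using equiv_proj_rel(2) [OF D assms(6) N, of "rep L"] \<open>rep L \<in> U\<close> by (simp add: U_def R_def)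
  qed
  have rep_U: "rep L \<in> U" if "L \<in> P" for L using assms(7) that UP by (auto simp: P_def)
  have cardL: "card L = \<phi>" if "L \<in> P" for L
    using L_rep [OF that] card_unit_orbit [OF N, of "rep L" n] rep_U [OF that] by (simp add: U_def \<phi>_def)
  \<comment> \<open>Scaling a direction by a unit only reparametrises its lines, so the choice of
    \<open>rep\<close> is immaterial.\<close>
  have F_const: "F u = F (rep L)" if L: "L \<in> P" and u: "u \<in> L" for L u
  proof -
    obtain c where c: "c \<in> Units (Zmod N)" "u = scale N n c (rep L)" using u L_rep [OF L] by (auto simp: unit_orbit_def)
    obtain d where d: "d * c mod int N = 1" using unit_inverse [OF N c(1)] by blast
    have "rep L = scale N n d u" using c(2) d rep_U [OF L] N by (simp add: scale_scale scale_by_one U_def unimod_def)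
    then have "line N n a u = line N n a (rep L)" for a
      using line_scale_subset [of N n a c "rep L"] line_scale_subset [of N n a d u] c(2) N by auto
    then show ?thesis by (simp add: F_def richest_def)
  qed
  have sumF: "(\<Sum>u\<in>U. F u) = real \<phi> * (\<Sum>L\<in>P. F (rep L))"
  proof -
    have "(\<Sum>u\<in>U. F u) = (\<Sum>L\<in>P. \<Sum>u\<in>L. F u)"
      unfolding UP [symmetric] using sum.Union_disjoint [OF finL disj] by simp
    also have "\<dots> = (\<Sum>L\<in>P. real \<phi> * F (rep L))"
      using F_const cardL by (intro sum.cong refl) simp
    finally show ?thesis by (simp add: sum_distrib_left)
  qed
  have cardU: "card U = \<phi> * card P"
  proof -
    have "card U = (\<Sum>L\<in>P. card L)"
      unfolding UP [symmetric] using disj finL by (intro card_Union_disjoint) (auto simp: pairwise_def disjnt_def)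
    then show ?thesis using cardL by simp
  qed
  have "kakeya_bound N n C"
  proof -
    have "kakeya_bound (\<Prod>i\<in>insert r {1..<r}. p i ^ k i) n
        (((\<Prod>i\<in>{1..<r}. 1 / (real (k i) * ln (real (p i)) + 1)) *
          (\<Prod>i\<in>insert r {1..<r}. 1 / (2 * (real (k i) + of_int \<lceil>log (real (p i)) (real n)\<rceil>)))) ^ n)"
      by (rule kakeya_bound_prod) (use assms(1) assms(3-5) [unfolded r] in auto)
    then show ?thesis unfolding r [symmetric] by (simp add: C_def kakeya_const_def assms(6) modulus_def)
  qed
  then have main: "C * (real \<phi> * (\<Sum>L\<in>P. F (rep L))) \<le> real (card S) * (real \<phi> * real (card P))"
    using assms(8) unfolding kakeya_bound_def sumF [symmetric] by (simp add: F_def U_def cardU [unfolded U_def])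
  have \<phi>: "\<phi> > 0"
  proof -
    have "finite (Units (Zmod N))" by (rule finite_subset [of _ "{0..int N}"]) (auto simp: Units_Zmod [OF N])
    moreover have "1 \<in> Units (Zmod N)" using N by (simp add: Units_Zmod)
    ultimately show ?thesis unfolding \<phi>_def by (auto simp: card_gt_0_iff)
  qed
  have C0: "C \<ge> 0"
    unfolding C_def kakeya_const_def
  proof (intro zero_le_power mult_nonneg_nonneg prod_nonneg ballI)
    fix i assume "i \<in> {1..r}"
    then have "log (real (p i)) (real n) \<ge> 0" using p1 [of i] assms(1) by simp
    then have "\<lceil>log (real (p i)) (real n)\<rceil> \<ge> 0" by linarith
    then show "0 \<le> 1 / (2 * (real (k i) + of_int \<lceil>log (real (p i)) (real n)\<rceil>))" by simp
  next
    fix i assume "i \<in> {1..<r}"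
    then have "ln (real (p i)) \<ge> 0" using p1 [of i] by simp
    then show "0 \<le> 1 / (real (k i) * ln (real (p i)) + 1)" by simp
  qed
  have sup: "(SUP a\<in>vecs N n. real (card (line N n a (rep L) \<inter> S)) ^ n) \<le> F (rep L)" for L
    unfolding F_def using N by (intro cSUP_least vecs_nonempty power_mono of_nat_mono card_line_le_richest) auto
  have "C * (\<Sum>L\<in>P. SUP a\<in>vecs N n. real (card (line N n a (rep L) \<inter> S)) ^ n) \<le> C * (\<Sum>L\<in>P. F (rep L))"
    by (intro mult_left_mono sum_mono sup C0)
  also have "\<dots> \<le> real (card S) * real (card P)"
    using main \<phi> by (simp add: mult.left_commute)
  finally have "C * (\<Sum>L\<in>P. SUP a\<in>vecs N n. real (card (line N n a (rep L) \<inter> S)) ^ n) \<le> real (card S) * real (card P)" .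
  \<comment> \<open>For \<open>card P = 0\<close> the right-hand side is 0 by the convention for
    division by zero.\<close>
  then show ?thesis
    by (cases "card P = 0") (simp_all add: C_def P_def divide_le_eq)
qed

end
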